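(* Let $\mathcal M$ be a three-dimensional non-para-Sasakian paracontact metric $(\kappa,\mu)$-space with structure $(\phi,\xi,\eta,g)$. Then around each point of $\mathcal M$ there is a local Artin frame $(\xi,E_1,E_2)$ such that, with a function $b$ and $\epsilon=\pm1$, $$[E_1,E_2]=-bE_2+2\xi,$$ $$[\xi,E_1]=\left(1-\tfrac{\mu}{2}\right)E_1+\epsilon E_2,\qquad [\xi,E_2]=-\epsilon(\kappa+1)E_1-\left(1-\tfrac{\mu}{2}\right)E_2,$$ and $b=0$ if $\kappa\neq-1$.
   Context: All manifolds, tensor fields and functions are smooth; manifolds are connected and without boundary. An almost paracontact metric structure on a $3$-dimensional manifold is a quadruple $(\phi,\xi,\eta,g)$: a $(1,1)$-tensor field $\phi$, a vector field $\xi$, a $1$-form $\eta$ and a pseudo-Riemannian metric $g$ of signature $(2,1)$ with $\phi^2=Id-\eta\otimes\xi$, $\eta(\xi)=1$, $g(\phi X,\phi Y)=-g(X,Y)+\eta(X)\eta(Y)$. The fundamental form is $\Phi(X,Y)=g(X,\phi Y)$. The structure is paracontact metric if $d\eta=\Phi$, where $2\,d\eta(X,Y)=X\eta(Y)-Y\eta(X)-\eta([X,Y])$. It is normal if $N_\phi-2\,d\eta\otimes\xi=0$, where $N_\phi(X,Y)=\phi^2[X,Y]+[\phi X,\phi Y]-\phi([\phi X,Y]+[X,\phi Y])$; para-Sasakian means paracontact metric and normal. Put $h=\frac12\mathcal L_\xi\phi$. Let $\nabla$ be the Levi-Civita connection of $g$ and $R_{XY}Z=[\nabla_X,\nabla_Y]Z-\nabla_{[X,Y]}Z$.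 The manifold is a $(\kappa,\mu)$-space, $\kappa,\mu\in\mathbb R$, if $R_{XY}\xi=\kappa(\eta(Y)X-\eta(X)Y)+\mu(\eta(Y)hX-\eta(X)hY)$ for all $X,Y$. A local Artin frame is a local frame $(\xi,E_1,E_2)$ with $\phi E_1=E_1$, $\phi E_2=-E_2$, $g(\xi,E_1)=g(\xi,E_2)=0$, $g(E_1,E_2)=1$ (then $g(E_1,E_1)=g(E_2,E_2)=0$).
   Formalization: For κ=−1 the claim is false as stated; it is proved there assuming the structure is normal at no point (not merely non-para-Sasakian), and after replacing (φ,ξ,η) by (−φ,−ξ,−η) on all of M if necessary. For κ≠−1 it is proved as stated. *)

theory Defs
  imports "HOL-Analysis.Analysis"
begin

section \<open>Smooth functions on open sets\<close>

primrec C_on :: "nat \<Rightarrow> 'v::real_normed_vector set \<Rightarrow> ('v \<Rightarrow> 'w::real_normed_vector) \<Rightarrow> bool" where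
  "C_on 0 S f \<longleftrightarrow> continuous_on S f"
| "C_on (Suc k) S f \<longleftrightarrow>
     (\<forall>x\<in>S. f differentiable (at x)) \<and>
     (\<forall>v. C_on k S (\<lambda>x. frechet_derivative f (at x) v))"

text \<open>Only used for open \<open>S\<close> in a Euclidean space, where it is the usual notion of
  \<open>C\<^sup>\<infinity>\<close>: all iterated directional derivatives exist and are continuous.\<close>

definition smooth_on :: "'v::real_normed_vector set \<Rightarrow> ('v \<Rightarrow> 'w::real_normed_vector) \<Rightarrow> bool" where
  "smooth_on S f \<longleftrightarrow> (\<forall>k. C_on k S f)"


section \<open>Calculus in one coordinate domain\<close>

text \<open>Vector fields on an open \<open>W\<close> in \<open>\<real>\<^sup>3\<close> are functions \<open>real^3 \<Rightarrow> real^3\<close> (values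
  outside \<open>W\<close> are irrelevant); tensor fields are functions of the base point and of
  tangent vectors.\<close>

type_synonym vfield = "real^3 \<Rightarrow> real^3"
type_synonym form1 = "real^3 \<Rightarrow> real^3 \<Rightarrow> real"
type_synonym tensor11 = "real^3 \<Rightarrow> real^3 \<Rightarrow> real^3"
type_synonym tensor02 = "real^3 \<Rightarrow> real^3 \<Rightarrow> real^3 \<Rightarrow> real"
type_synonym connection = "real^3 \<Rightarrow> real^3 \<Rightarrow> real^3 \<Rightarrow> real^3"

definition along :: "vfield \<Rightarrow> (real^3 \<Rightarrow> 'w::real_normed_vector) \<Rightarrow> real^3 \<Rightarrow> 'w" where
  "along X f u = frechet_derivative f (at u) (X u)"

definition bracket :: "vfield \<Rightarrow> vfield \<Rightarrow> vfield" where
  "bracket X Y u = along X Y u - along Y X u"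

definition app :: "(real^3 \<Rightarrow> real^3 \<Rightarrow> 'w) \<Rightarrow> vfield \<Rightarrow> real^3 \<Rightarrow> 'w" where
  "app T X u = T u (X u)"

definition d1 :: "form1 \<Rightarrow> vfield \<Rightarrow> vfield \<Rightarrow> real^3 \<Rightarrow> real" where
  "d1 \<eta> X Y u = (along X (app \<eta> Y) u - along Y (app \<eta> X) u - \<eta> u (bracket X Y u)) / 2"

definition nijenhuis :: "tensor11 \<Rightarrow> vfield \<Rightarrow> vfield \<Rightarrow> vfield" where
  "nijenhuis \<phi> X Y u =
     \<phi> u (\<phi> u (bracket X Y u)) + bracket (app \<phi> X) (app \<phi> Y) u
     - \<phi> u (bracket (app \<phi> X) Y u + bracket X (app \<phi> Y) u)"

definition normality_tensor :: "tensor11 \<Rightarrow> vfield \<Rightarrow> form1 \<Rightarrow> vfield \<Rightarrow> vfield \<Rightarrow> vfield" where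
  "normality_tensor \<phi> \<xi> \<eta> X Y u = nijenhuis \<phi> X Y u - (2 * d1 \<eta> X Y u) *\<^sub>R \<xi> u"

definition lie_derivative :: "vfield \<Rightarrow> tensor11 \<Rightarrow> vfield \<Rightarrow> vfield" where
  "lie_derivative \<xi> \<phi> X u = bracket \<xi> (app \<phi> X) u - \<phi> u (bracket \<xi> X u)"

definition h_tensor :: "tensor11 \<Rightarrow> vfield \<Rightarrow> vfield \<Rightarrow> vfield" where
  "h_tensor \<phi> \<xi> X u = (1/2) *\<^sub>R lie_derivative \<xi> \<phi> X u"

text \<open>In coordinates an affine connection is flat differentiation plus a smooth field
  \<open>\<Gamma>\<close> of bilinear maps (its Christoffel symbols).\<close>

definition nabla :: "connection \<Rightarrow> vfield \<Rightarrow> vfield \<Rightarrow> vfield" where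
  "nabla \<Gamma> X Y u = along X Y u + \<Gamma> u (X u) (Y u)"

definition levi_civita :: "(real^3) set \<Rightarrow> tensor02 \<Rightarrow> connection \<Rightarrow> bool" where
  "levi_civita W g \<Gamma> \<longleftrightarrow>
     (\<forall>u\<in>W. bilinear (\<Gamma> u)) \<and>
     (\<forall>v w. smooth_on W (\<lambda>u. \<Gamma> u v w)) \<and>
     (\<forall>X Y. smooth_on W X \<longrightarrow> smooth_on W Y \<longrightarrow>
        (\<forall>u\<in>W. nabla \<Gamma> X Y u - nabla \<Gamma> Y X u = bracket X Y u)) \<and>
     (\<forall>X Y Z. smooth_on W X \<longrightarrow> smooth_on W Y \<longrightarrow> smooth_on W Z \<longrightarrow>
        (\<forall>u\<in>W. along X (\<lambda>u. g u (Y u) (Z u)) u =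
                g u (nabla \<Gamma> X Y u) (Z u) + g u (Y u) (nabla \<Gamma> X Z u)))"

definition curvature :: "connection \<Rightarrow> vfield \<Rightarrow> vfield \<Rightarrow> vfield \<Rightarrow> vfield" where
  "curvature \<Gamma> X Y Z u =
     nabla \<Gamma> X (nabla \<Gamma> Y Z) u - nabla \<Gamma> Y (nabla \<Gamma> X Z) u - nabla \<Gamma> (bracket X Y) Z u"

text \<open>Signature \<open>(2,1)\<close>; the three indices of type \<^typ>\<open>3\<close> are \<open>1\<close>, \<open>2\<close> and \<open>3\<close>.\<close>

definition lorentzian :: "(real^3 \<Rightarrow> real^3 \<Rightarrow> real) \<Rightarrow> bool" where
  "lorentzian B \<longleftrightarrow> bilinear B \<and> (\<forall>v w. B v w = B w v) \<and>
     (\<exists>e :: 3 \<Rightarrow> real^3. \<forall>i j. B (e i) (e j) = (if i \<noteq> j then 0 else if i = 3 then -1 else 1))"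


section \<open>Three-dimensional manifolds and their tensor fields\<close>

type_synonym 'a chart = "'a set \<times> ('a \<Rightarrow> real^3)"

definition coords :: "'a chart \<Rightarrow> 'a set \<Rightarrow> (real^3) set" where
  "coords c U = snd c ` (fst c \<inter> U)"

definition point_of :: "'a chart \<Rightarrow> real^3 \<Rightarrow> 'a" where
  "point_of c = inv_into (fst c) (snd c)"

definition transition :: "'a chart \<Rightarrow> 'a chart \<Rightarrow> real^3 \<Rightarrow> real^3" where
  "transition c d u = snd d (point_of c u)"

definition jacobian :: "'a chart \<Rightarrow> 'a chart \<Rightarrow> real^3 \<Rightarrow> real^3 \<Rightarrow> real^3" where
  "jacobian c d u = frechet_derivative (transition c d) (at u)"

definition chart_of :: "'a topology \<Rightarrow> 'a chart \<Rightarrow> bool" where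
  "chart_of M c \<longleftrightarrow> openin M (fst c) \<and> open (snd c ` fst c) \<and>
     homeomorphic_map (subtopology M (fst c)) (top_of_set (snd c ` fst c)) (snd c)"

definition smooth_3manifold :: "'a topology \<Rightarrow> 'a chart set \<Rightarrow> bool" where
  "smooth_3manifold M A \<longleftrightarrow>
     Hausdorff_space M \<and> second_countable M \<and> connected_space M \<and>
     (\<forall>c\<in>A. chart_of M c) \<and> (\<Union>c\<in>A. fst c) = topspace M \<and>
     (\<forall>c\<in>A. \<forall>d\<in>A. smooth_on (coords c (fst d)) (transition c d))"

text \<open>A tensor field on an open set \<open>U\<close> of the manifold is the family of its coordinate
  expressions in the charts of the atlas, subject to the transformation law.\<close>

definition scalar_field :: "'a chart set \<Rightarrow> 'a set \<Rightarrow> ('a \<Rightarrow> real) \<Rightarrow> bool" where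
  "scalar_field A U f \<longleftrightarrow> (\<forall>c\<in>A. smooth_on (coords c U) (\<lambda>u. f (point_of c u)))"

definition vector_field :: "'a chart set \<Rightarrow> 'a set \<Rightarrow> ('a chart \<Rightarrow> vfield) \<Rightarrow> bool" where
  "vector_field A U X \<longleftrightarrow>
     (\<forall>c\<in>A. smooth_on (coords c U) (X c)) \<and>
     (\<forall>c\<in>A. \<forall>d\<in>A. \<forall>u\<in>coords c (fst d \<inter> U).
        X d (transition c d u) = jacobian c d u (X c u))"

definition one_form :: "'a chart set \<Rightarrow> 'a set \<Rightarrow> ('a chart \<Rightarrow> form1) \<Rightarrow> bool" where
  "one_form A U \<eta> \<longleftrightarrow>
     (\<forall>c\<in>A. (\<forall>u\<in>coords c U. linear (\<eta> c u)) \<and> (\<forall>v. smooth_on (coords c U) (\<lambda>u. \<eta> c u v))) \<and>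
     (\<forall>c\<in>A. \<forall>d\<in>A. \<forall>u\<in>coords c (fst d \<inter> U). \<forall>v.
        \<eta> d (transition c d u) (jacobian c d u v) = \<eta> c u v)"

definition endo_field :: "'a chart set \<Rightarrow> 'a set \<Rightarrow> ('a chart \<Rightarrow> tensor11) \<Rightarrow> bool" where
  "endo_field A U \<phi> \<longleftrightarrow>
     (\<forall>c\<in>A. (\<forall>u\<in>coords c U. linear (\<phi> c u)) \<and> (\<forall>v. smooth_on (coords c U) (\<lambda>u. \<phi> c u v))) \<and>
     (\<forall>c\<in>A. \<forall>d\<in>A. \<forall>u\<in>coords c (fst d \<inter> U). \<forall>v.
        \<phi> d (transition c d u) (jacobian c d u v) = jacobian c d u (\<phi> c u v))"

definition lorentz_metric :: "'a chart set \<Rightarrow> 'a set \<Rightarrow> ('a chart \<Rightarrow> tensor02) \<Rightarrow> bool" where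
  "lorentz_metric A U g \<longleftrightarrow>
     (\<forall>c\<in>A. (\<forall>u\<in>coords c U. lorentzian (g c u)) \<and>
             (\<forall>v w. smooth_on (coords c U) (\<lambda>u. g c u v w))) \<and>
     (\<forall>c\<in>A. \<forall>d\<in>A. \<forall>u\<in>coords c (fst d \<inter> U). \<forall>v w.
        g d (transition c d u) (jacobian c d u v) (jacobian c d u w) = g c u v w)"


section \<open>Paracontact metric structures\<close>

text \<open>Below, identities between tensor fields are required in every chart, on the whole chart
  domain, and \<open>X\<close>, \<open>Y\<close> range over all smooth vector fields on that domain. The identities
  are tensorial, so this is the same as requiring them for vector fields on the manifold.\<close>

definition almost_paracontact_metric ::
  "'a topology \<Rightarrow> 'a chart set \<Rightarrow> ('a chart \<Rightarrow> tensor11) \<Rightarrow> ('a chart \<Rightarrow> vfield) \<Rightarrow>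
   ('a chart \<Rightarrow> form1) \<Rightarrow> ('a chart \<Rightarrow> tensor02) \<Rightarrow> bool" where
  "almost_paracontact_metric M A \<phi> \<xi> \<eta> g \<longleftrightarrow>
     endo_field A (topspace M) \<phi> \<and> vector_field A (topspace M) \<xi> \<and>
     one_form A (topspace M) \<eta> \<and> lorentz_metric A (topspace M) g \<and>
     (\<forall>c\<in>A. \<forall>u\<in>coords c (topspace M).
        (\<forall>v. \<phi> c u (\<phi> c u v) = v - \<eta> c u v *\<^sub>R \<xi> c u) \<and>
        \<eta> c u (\<xi> c u) = 1 \<and>
        (\<forall>v w. g c u (\<phi> c u v) (\<phi> c u w) = - g c u v w + \<eta> c u v * \<eta> c u w))"

definition fundamental_form :: "tensor11 \<Rightarrow> tensor02 \<Rightarrow> tensor02" where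
  "fundamental_form \<phi> g u v w = g u v (\<phi> u w)"

definition paracontact_metric ::
  "'a topology \<Rightarrow> 'a chart set \<Rightarrow> ('a chart \<Rightarrow> tensor11) \<Rightarrow> ('a chart \<Rightarrow> vfield) \<Rightarrow>
   ('a chart \<Rightarrow> form1) \<Rightarrow> ('a chart \<Rightarrow> tensor02) \<Rightarrow> bool" where
  "paracontact_metric M A \<phi> \<xi> \<eta> g \<longleftrightarrow>
     almost_paracontact_metric M A \<phi> \<xi> \<eta> g \<and>
     (\<forall>c\<in>A. let W = coords c (topspace M) in
        \<forall>X Y. smooth_on W X \<longrightarrow> smooth_on W Y \<longrightarrow>
          (\<forall>u\<in>W. d1 (\<eta> c) X Y u = fundamental_form (\<phi> c) (g c) u (X u) (Y u)))"

definition normal_at ::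
  "'a topology \<Rightarrow> 'a chart set \<Rightarrow> ('a chart \<Rightarrow> tensor11) \<Rightarrow> ('a chart \<Rightarrow> vfield) \<Rightarrow>
   ('a chart \<Rightarrow> form1) \<Rightarrow> 'a \<Rightarrow> bool" where
  "normal_at M A \<phi> \<xi> \<eta> p \<longleftrightarrow>
     (\<forall>c\<in>A. p \<in> fst c \<longrightarrow> (let W = coords c (topspace M) in
        \<forall>X Y. smooth_on W X \<longrightarrow> smooth_on W Y \<longrightarrow>
          normality_tensor (\<phi> c) (\<xi> c) (\<eta> c) X Y (snd c p) = 0))"

definition para_sasakian ::
  "'a topology \<Rightarrow> 'a chart set \<Rightarrow> ('a chart \<Rightarrow> tensor11) \<Rightarrow> ('a chart \<Rightarrow> vfield) \<Rightarrow>
   ('a chart \<Rightarrow> form1) \<Rightarrow> ('a chart \<Rightarrow> tensor02) \<Rightarrow> bool" where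
  "para_sasakian M A \<phi> \<xi> \<eta> g \<longleftrightarrow>
     paracontact_metric M A \<phi> \<xi> \<eta> g \<and> (\<forall>p\<in>topspace M. normal_at M A \<phi> \<xi> \<eta> p)"

text \<open>The Levi-Civita connection of a metric exists and is unique on each chart domain, so the
  existential quantifier merely names it.\<close>

definition kappa_mu_space ::
  "'a topology \<Rightarrow> 'a chart set \<Rightarrow> ('a chart \<Rightarrow> tensor11) \<Rightarrow> ('a chart \<Rightarrow> vfield) \<Rightarrow>
   ('a chart \<Rightarrow> form1) \<Rightarrow> ('a chart \<Rightarrow> tensor02) \<Rightarrow> real \<Rightarrow> real \<Rightarrow> bool" where
  "kappa_mu_space M A \<phi> \<xi> \<eta> g \<kappa> \<mu> \<longleftrightarrow>
     (\<forall>c\<in>A. let W = coords c (topspace M) in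
        \<exists>\<Gamma>. levi_civita W (g c) \<Gamma> \<and>
          (\<forall>X Y. smooth_on W X \<longrightarrow> smooth_on W Y \<longrightarrow>
            (\<forall>u\<in>W. curvature \<Gamma> X Y (\<xi> c) u =
               \<kappa> *\<^sub>R (\<eta> c u (Y u) *\<^sub>R X u - \<eta> c u (X u) *\<^sub>R Y u) +
               \<mu> *\<^sub>R (\<eta> c u (Y u) *\<^sub>R h_tensor (\<phi> c) (\<xi> c) X u -
                     \<eta> c u (X u) *\<^sub>R h_tensor (\<phi> c) (\<xi> c) Y u))))"

definition artin_frame ::
  "'a chart set \<Rightarrow> 'a set \<Rightarrow> ('a chart \<Rightarrow> tensor11) \<Rightarrow> ('a chart \<Rightarrow> vfield) \<Rightarrow>
   ('a chart \<Rightarrow> tensor02) \<Rightarrow> ('a chart \<Rightarrow> vfield) \<Rightarrow> ('a chart \<Rightarrow> vfield) \<Rightarrow> bool" where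
  "artin_frame A U \<phi> \<xi> g E1 E2 \<longleftrightarrow>
     vector_field A U E1 \<and> vector_field A U E2 \<and>
     (\<forall>c\<in>A. \<forall>u\<in>coords c U.
        span {\<xi> c u, E1 c u, E2 c u} = UNIV \<and>
        \<phi> c u (E1 c u) = E1 c u \<and> \<phi> c u (E2 c u) = - E2 c u \<and>
        g c u (\<xi> c u) (E1 c u) = 0 \<and> g c u (\<xi> c u) (E2 c u) = 0 \<and>
        g c u (E1 c u) (E2 c u) = 1)"

end

theory Submission
  imports Defs
begin

text \<open>
  Let \<open>E1\<close>, \<open>E2\<close> be a local null frame of \<open>ker \<eta>\<close> adapted to \<open>\<phi>\<close>. Closedness of the fundamental form
  gives \<open>[\<xi>,E1] = p E1 + q E2\<close>, \<open>[\<xi>,E2] = r E1 - p E2\<close>, \<open>[E1,E2] = a E1 - b E2 + 2\<xi>\<close>. Then \<open>h E1 = q E2\<close>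
  and \<open>h E2 = - r E1\<close>, so the structure is normal exactly where \<open>q = r = 0\<close>, and the curvature condition becomes
  \<open>q r = - (\<kappa> + 1)\<close>, \<open>\<xi> q = (\<mu> - 2 + 2 p) q\<close>, \<open>\<xi> r = (2 - \<mu> - 2 p) r\<close>, \<open>E1 r = - 2 b r\<close>, \<open>E2 q = - 2 a q\<close>.
  Where \<open>q \<noteq> 0\<close>, rescaling \<open>E1\<close> by \<open>\<bar>q\<bar>\<^sup>-\<^sup>1\<^sup>/\<^sup>2\<close> makes \<open>q = \<plusminus>1\<close>, and constancy of \<open>q\<close> (and of \<open>r\<close>) fixes
  \<open>p\<close>, \<open>a\<close> (and \<open>b\<close>). If \<open>\<kappa> = -1\<close>, exactly one of \<open>q\<close>, \<open>r\<close> is nonzero at each point, by connectedness the same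
  one everywhere; when it is \<open>r\<close>, reversing the signs of \<open>\<phi>\<close> and \<open>\<xi>\<close> exchanges the roles of \<open>E1\<close> and \<open>E2\<close>.
\<close>

section \<open>Smooth maps\<close>

text \<open>The eigenspaces of \<phi> fix the frame up to \<open>(f E1, E2 / f)\<close>, which turns
  \<open>q\<close> into f^2 q and \<open>r\<close> into r / f^2. The product and both signs are
  therefore invariants, and only one of the two can be normalised; the target form normalises
  \<open>q\<close>. Since h^2 = (\<kappa> + 1) \<phi>^2, \<open>q\<close> has no zeros for \<kappa>
  \<noteq> -1. For \<kappa> = -1 the operator \<open>h\<close> is nilpotent, and where it kills
  \<open>E1\<close> no frame adapted to \<phi> has the target form. The way out is the structure
  (-\<phi>, -\<xi>, -\<eta>, g): it has the same \<open>h\<close>, \<kappa> and \<mu>, and its +1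
  eigenspace is the old -1 eigenspace. The sign has to be the same over the whole manifold, so the
  two alternatives are shown to be open and mutually exclusive. A second obstacle: the hypotheses
  speak of fields smooth on a whole chart domain, while frames live on smaller open sets. They are
  therefore reduced to identities between coefficients at one point.\<close>

abbreviation D where "D f x v \<equiv> frechet_derivative f (at x) v"

lemma D_eqI: "(f has_derivative f') (at x) \<Longrightarrow> D f x v = f' v"
  by (simp add: frechet_derivative_at[symmetric])

text \<open>Derivatives at points of an open set see only a neighbourhood, so the values of the
  total functions off \<open>S\<close> do not matter. This lets identities that hold only on a chart
  domain be used under derivatives.\<close>

lemma C_on_cong:
  assumes "open S" "\<And>x. x \<in> S \<Longrightarrow> f x = g x"
  shows "C_on k S f \<longleftrightarrow> C_on k S g"
  using assms(2)
proof (induction k arbitrary: f g)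
  case 0
  then show ?case using continuous_on_cong by fastforce
next
  case (Suc k)
  have d: "f differentiable at x \<longleftrightarrow> g differentiable at x" if "x \<in> S" for x
    using has_derivative_transform_within_open[OF _ assms(1) that, of f _ UNIV g]
      has_derivative_transform_within_open[OF _ assms(1) that, of g _ UNIV f] Suc.prems
    unfolding differentiable_def by metis
  have e: "D f x v = D g x v" if "x \<in> S" "\<forall>x\<in>S. f differentiable at x" for x v
    using frechet_derivative_transform_within_open[OF _ assms(1) that(1) Suc.prems] that by simp
  have "C_on k S (\<lambda>x. D f x v) \<longleftrightarrow> C_on k S (\<lambda>x. D g x v)" if "\<forall>x\<in>S. f differentiable at x" for v
    using that by (intro Suc.IH e) auto
  then show ?case using d by auto
qed

lemma C_on_subset: "C_on k S f \<Longrightarrow> T \<subseteq> S \<Longrightarrow> C_on k T f"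
  by (induction k arbitrary: f) (auto intro: continuous_on_subset)

lemma C_on_SucD: "C_on (Suc k) S f \<Longrightarrow> C_on k S f"
proof (induction k arbitrary: f)
  case 0
  then show ?case
    by (auto intro!: continuous_at_imp_continuous_on differentiable_imp_continuous_within)
qed auto

text \<open>Each closure rule below supplies an explicit derivative; only its values in fixed
  directions have to be \<open>C_on\<close>, so no topology on spaces of linear maps is
  involved.\<close>

lemma C_on_SucI:
  assumes "open S" "\<And>x. x \<in> S \<Longrightarrow> (f has_derivative f' x) (at x)"
    "\<And>v. C_on k S (\<lambda>x. f' x v)"
  shows "C_on (Suc k) S f"
proof -
  have "C_on k S (\<lambda>x. D f x v)" for v
    using C_on_cong[OF assms(1), of "\<lambda>x. D f x v" "\<lambda>x. f' x v"] assms(2,3) by (simp add: D_eqI)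
  then show ?thesis using assms(2) by (auto simp: differentiable_def)
qed

lemma C_on_Suc_has_derivative:
  "C_on (Suc k) S f \<Longrightarrow> x \<in> S \<Longrightarrow> (f has_derivative D f x) (at x)"
  by (simp add: frechet_derivative_works)

lemma C_on_const: "C_on k S (\<lambda>x. c)"
  by (induction k arbitrary: c) auto

lemma C_on_linear:
  assumes "bounded_linear L" "open S"
  shows "C_on k S f \<Longrightarrow> C_on k S (\<lambda>x. L (f x))"
proof (induction k arbitrary: f)
  case 0
  then show ?case by (simp add: bounded_linear.continuous_on[OF assms(1)])
next
  case (Suc k)
  show ?case
    by (rule C_on_SucI[OF assms(2), where f' = "\<lambda>x v. L (D f x v)"])
      (use Suc in \<open>auto intro!: bounded_linear.has_derivative[OF assms(1)] C_on_Suc_has_derivative[OF Suc.prems]\<close>)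
qed

lemma C_on_add:
  assumes "open S"
  shows "C_on k S f \<Longrightarrow> C_on k S g \<Longrightarrow> C_on k S (\<lambda>x. f x + g x)"
proof (induction k arbitrary: f g)
  case 0
  then show ?case by (simp add: continuous_on_add)
next
  case (Suc k)
  show ?case
    by (rule C_on_SucI[OF assms, where f' = "\<lambda>x v. D f x v + D g x v"])
      (use Suc in \<open>auto intro!: has_derivative_add C_on_Suc_has_derivative[OF Suc.prems(1)]
        C_on_Suc_has_derivative[OF Suc.prems(2)]\<close>)
qed

lemma C_on_bilinear:
  assumes "bounded_bilinear B" "open S"
  shows "C_on k S f \<Longrightarrow> C_on k S g \<Longrightarrow> C_on k S (\<lambda>x. B (f x) (g x))"
proof (induction k arbitrary: f g)
  case 0
  then show ?case by (simp add: bounded_bilinear.continuous_on[OF assms(1)])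
next
  case (Suc k)
  show ?case
  proof (rule C_on_SucI[OF assms(2), where f' = "\<lambda>x v. B (f x) (D g x v) + B (D f x v) (g x)"])
    show "((\<lambda>x. B (f x) (g x)) has_derivative (\<lambda>v. B (f x) (D g x v) + B (D f x v) (g x))) (at x)"
      if "x \<in> S" for x
      using bounded_bilinear.FDERIV[OF assms(1) C_on_Suc_has_derivative[OF Suc.prems(1) that]
          C_on_Suc_has_derivative[OF Suc.prems(2) that]] .
    show "C_on k S (\<lambda>x. B (f x) (D g x v) + B (D f x v) (g x))" for v
      using Suc.prems by (intro C_on_add[OF assms(2)] Suc.IH) (auto intro: C_on_SucD simp del: C_on.simps(2) simp: C_on.simps(2)[of k])
  qed
qed

lemma C_on_sum:
  assumes "open S" "finite I" "\<And>i. i \<in> I \<Longrightarrow> C_on k S (f i)"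
  shows "C_on k S (\<lambda>x. \<Sum>i\<in>I. f i x)"
  using assms(2,3) by (induction rule: finite_induct) (auto intro!: C_on_add C_on_const assms(1))

text \<open>Turns a field of linear maps applied to a varying vector into a finite sum of scalar
  functions times fixed-direction values, the form that \<open>C_on\<close> and the product rule can
  handle.\<close>

lemma linear_Basis_sum:
  fixes x :: "'a::euclidean_space"
  assumes "linear L"
  shows "L x = (\<Sum>b\<in>Basis. (x \<bullet> b) *\<^sub>R L b)"
proof -
  have "L x = L (\<Sum>b\<in>Basis. (x \<bullet> b) *\<^sub>R b)" by (simp add: euclidean_representation)
  also have "\<dots> = (\<Sum>b\<in>Basis. (x \<bullet> b) *\<^sub>R L b)"
    by (simp add: linear_sum[OF assms] linear_scale[OF assms])
  finally show ?thesis .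
qed

text \<open>In the chain rule \<open>D g (f x) (D f x v)\<close> the direction varies with
  \<open>x\<close>, so the induction hypothesis does not apply to it directly. Expanding
  \<open>D f x v\<close> in the basis leaves scalar multiples of \<open>D g (f x) b\<close> with
  \<open>b\<close> fixed.\<close>

lemma C_on_compose:
  fixes f :: "'a::euclidean_space \<Rightarrow> 'b::euclidean_space" and g :: "'b \<Rightarrow> 'c::real_normed_vector"
  assumes "open S" "open T" "f ` S \<subseteq> T"
  shows "C_on k S f \<Longrightarrow> C_on k T g \<Longrightarrow> C_on k S (\<lambda>x. g (f x))"
proof (induction k arbitrary: g)
  case 0
  then show ?case using continuous_on_compose2 assms(3) by (simp, blast)
next
  case (Suc k)
  have gd: "(g has_derivative D g y) (at y)" if "y \<in> T" for y
    using Suc.prems(2) that by (rule C_on_Suc_has_derivative)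
  show ?case
  proof (rule C_on_SucI[OF assms(1), where f' = "\<lambda>x v. \<Sum>b\<in>Basis. (D f x v \<bullet> b) *\<^sub>R D g (f x) b"])
    fix x assume x: "x \<in> S"
    have "linear (D g (f x))" using gd[of "f x"] x assms(3) by (auto intro: has_derivative_linear)
    then have eq: "(\<lambda>v. D g (f x) (D f x v)) = (\<lambda>v. \<Sum>b\<in>Basis. (D f x v \<bullet> b) *\<^sub>R D g (f x) b)"
      by (intro ext linear_Basis_sum)
    have "((\<lambda>x. g (f x)) has_derivative (\<lambda>v. D g (f x) (D f x v))) (at x)"
      using has_derivative_compose[OF C_on_Suc_has_derivative[OF Suc.prems(1) x] gd] x assms(3) by auto
    then show "((\<lambda>x. g (f x)) has_derivative (\<lambda>v. \<Sum>b\<in>Basis. (D f x v \<bullet> b) *\<^sub>R D g (f x) b)) (at x)"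
      unfolding eq .
  next
    fix v
    have "C_on k S (\<lambda>x. (D f x v \<bullet> b) *\<^sub>R D g (f x) b)" for b
      using Suc.prems
      by (intro C_on_bilinear[OF bounded_bilinear_scaleR assms(1)] Suc.IH
        C_on_linear[OF bounded_linear_inner_left assms(1)] C_on_SucD[OF Suc.prems(1)]) auto
    then show "C_on k S (\<lambda>x. \<Sum>b\<in>Basis. (D f x v \<bullet> b) *\<^sub>R D g (f x) b)"
      by (intro C_on_sum assms) auto
  qed
qed

text \<open>Differentiation lowers the exponent by one, so the induction must run over all exponents
  at once.\<close>

lemma C_on_powr:
  fixes q :: "'a::real_normed_vector \<Rightarrow> real"
  assumes "open S" "\<And>x. x \<in> S \<Longrightarrow> 0 < q x"
  shows "C_on k S q \<Longrightarrow> C_on k S (\<lambda>x. q x powr a)"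
proof (induction k arbitrary: a)
  case 0
  then show ?case using assms(2) by (fastforce intro!: continuous_on_powr)
next
  case (Suc k)
  show ?case
  proof (rule C_on_SucI[OF assms(1), where f' = "\<lambda>x v. (a * (q x powr (a - 1))) * D q x v"])
    fix x assume x: "x \<in> S"
    then have p: "0 < q x" using assms by auto
    have "((\<lambda>x. q x powr a) has_derivative (\<lambda>v. (q x powr a) * (0 * ln (q x) + D q x v * a / q x))) (at x)"
      using has_derivative_powr[OF C_on_Suc_has_derivative[OF Suc.prems x] has_derivative_const p] by simp
    then show "((\<lambda>x. q x powr a) has_derivative (\<lambda>v. (a * (q x powr (a - 1))) * D q x v)) (at x)"
      using p by (simp add: powr_diff field_simps)
  next
    fix v
    show "C_on k S (\<lambda>x. (a * (q x powr (a - 1))) * D q x v)"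
      using Suc.prems
      by (intro C_on_bilinear[OF bounded_bilinear_mult assms(1)] C_on_linear[OF bounded_linear_mult_right assms(1)] Suc.IH
          C_on_SucD[OF Suc.prems(1)]) auto
  qed
qed

lemma smooth_on_cong:
  "open S \<Longrightarrow> (\<And>x. x \<in> S \<Longrightarrow> f x = g x) \<Longrightarrow> smooth_on S f \<longleftrightarrow> smooth_on S g"
  unfolding smooth_on_def using C_on_cong by blast

lemma smooth_on_subset: "smooth_on S f \<Longrightarrow> T \<subseteq> S \<Longrightarrow> smooth_on T f"
  unfolding smooth_on_def using C_on_subset by blast

lemma smooth_on_const: "smooth_on S (\<lambda>x. c)"
  by (simp add: smooth_on_def C_on_const)

lemma smooth_on_linear:
  "bounded_linear L \<Longrightarrow> open S \<Longrightarrow> smooth_on S f \<Longrightarrow> smooth_on S (\<lambda>x. L (f x))"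
  by (simp add: smooth_on_def C_on_linear)

lemma smooth_on_add:
  "open S \<Longrightarrow> smooth_on S f \<Longrightarrow> smooth_on S g \<Longrightarrow> smooth_on S (\<lambda>x. f x + g x)"
  by (simp add: smooth_on_def C_on_add)

lemma smooth_on_minus: "open S \<Longrightarrow> smooth_on S f \<Longrightarrow> smooth_on S (\<lambda>x. - f x)"
  by (rule smooth_on_linear[OF bounded_linear_minus[OF bounded_linear_ident]])

lemma smooth_on_diff:
  "open S \<Longrightarrow> smooth_on S f \<Longrightarrow> smooth_on S g \<Longrightarrow> smooth_on S (\<lambda>x. f x - g x)"
  using smooth_on_add[of S f "\<lambda>x. - g x"] smooth_on_minus by auto

lemma smooth_on_scaleR:
  "open S \<Longrightarrow> smooth_on S f \<Longrightarrow> smooth_on S g \<Longrightarrow> smooth_on S (\<lambda>x. f x *\<^sub>R g x)"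
  by (simp add: smooth_on_def C_on_bilinear[OF bounded_bilinear_scaleR])

lemma smooth_on_sum:
  "open S \<Longrightarrow> finite I \<Longrightarrow> (\<And>i. i \<in> I \<Longrightarrow> smooth_on S (f i)) \<Longrightarrow> smooth_on S (\<lambda>x. \<Sum>i\<in>I. f i x)"
  by (simp add: smooth_on_def C_on_sum)

lemma smooth_on_compose:
  fixes f :: "'a::euclidean_space \<Rightarrow> 'b::euclidean_space"
  shows "open S \<Longrightarrow> open T \<Longrightarrow> f ` S \<subseteq> T \<Longrightarrow> smooth_on S f \<Longrightarrow> smooth_on T g \<Longrightarrow> smooth_on S (\<lambda>x. g (f x))"
  unfolding smooth_on_def using C_on_compose by blast

lemma smooth_on_powr:
  fixes q :: "'a::real_normed_vector \<Rightarrow> real"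
  shows "open S \<Longrightarrow> (\<And>x. x \<in> S \<Longrightarrow> 0 < q x) \<Longrightarrow> smooth_on S q \<Longrightarrow> smooth_on S (\<lambda>x. q x powr a)"
  by (simp add: smooth_on_def C_on_powr)

lemma smooth_on_D: "smooth_on S f \<Longrightarrow> smooth_on S (\<lambda>x. D f x v)"
  unfolding smooth_on_def using C_on.simps(2) by blast

lemma smooth_on_differentiable: "smooth_on S f \<Longrightarrow> x \<in> S \<Longrightarrow> f differentiable at x"
  unfolding smooth_on_def using C_on.simps(2) by blast

lemma smooth_on_has_derivative: "smooth_on S f \<Longrightarrow> x \<in> S \<Longrightarrow> (f has_derivative D f x) (at x)"
  using smooth_on_differentiable frechet_derivative_works by blast

lemma smooth_on_continuous: "smooth_on S f \<Longrightarrow> continuous_on S f"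
  unfolding smooth_on_def using C_on.simps(1) by blast

lemma smooth_on_app:
  fixes T :: "'b::real_normed_vector \<Rightarrow> 'a::euclidean_space \<Rightarrow> 'c::real_normed_vector"
  assumes "open S" "\<And>x. x \<in> S \<Longrightarrow> linear (T x)" "\<And>v. smooth_on S (\<lambda>x. T x v)" "smooth_on S Y"
  shows "smooth_on S (\<lambda>x. T x (Y x))"
proof -
  have "smooth_on S (\<lambda>x. \<Sum>b\<in>Basis. (Y x \<bullet> b) *\<^sub>R T x b)"
    using assms by (intro smooth_on_sum smooth_on_scaleR smooth_on_linear[OF bounded_linear_inner_left]) auto
  moreover have "T x (Y x) = (\<Sum>b\<in>Basis. (Y x \<bullet> b) *\<^sub>R T x b)" if "x \<in> S" for x
    by (rule linear_Basis_sum[OF assms(2)[OF that]])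
  ultimately show ?thesis by (subst smooth_on_cong[OF assms(1)])
qed

text \<open>Basis expansion reduces this to the scalar product rule: coefficients vary with the
  vector frozen, then the vector varies with the coefficients frozen. \<open>x0\<close> is a second
  name for the point, which the bound \<open>x\<close> would otherwise hide.\<close>

lemma has_derivative_app:
  fixes T :: "'b::real_normed_vector \<Rightarrow> 'a::euclidean_space \<Rightarrow> 'c::real_normed_vector"
  assumes "open S" "x \<in> S" "\<And>x. x \<in> S \<Longrightarrow> linear (T x)" "\<And>v. (\<lambda>x. T x v) differentiable at x"
    "Y differentiable at x" "x0 = x"
  shows "((\<lambda>x. T x (Y x)) has_derivative (\<lambda>v. D (\<lambda>x. T x (Y x0)) x v + T x (D Y x v))) (at x)"
proof -
  have T: "((\<lambda>x. T x b) has_derivative D (\<lambda>x. T x b) x) (at x)" for b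
    using assms(4) frechet_derivative_works by blast
  have Y: "(Y has_derivative D Y x) (at x)"
    using assms(5) frechet_derivative_works by blast
  have "((\<lambda>z. \<Sum>b\<in>Basis. (Y x \<bullet> b) *\<^sub>R T z b) has_derivative
      (\<lambda>v. \<Sum>b\<in>Basis. (Y x \<bullet> b) *\<^sub>R D (\<lambda>x. T x b) x v)) (at x)"
    by (intro has_derivative_sum has_derivative_scaleR_right T)
  then have "((\<lambda>z. T z (Y x)) has_derivative
      (\<lambda>v. \<Sum>b\<in>Basis. (Y x \<bullet> b) *\<^sub>R D (\<lambda>x. T x b) x v)) (at x)"
    by (rule has_derivative_transform_within_open[OF _ assms(1,2)]) (rule linear_Basis_sum[symmetric], rule assms(3))
  then have 1: "D (\<lambda>x. T x (Y x0)) x v = (\<Sum>b\<in>Basis. (Y x \<bullet> b) *\<^sub>R D (\<lambda>x. T x b) x v)" for v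
    using assms(6) by (simp add: D_eqI)
  have "((\<lambda>z. \<Sum>b\<in>Basis. (Y z \<bullet> b) *\<^sub>R T z b) has_derivative
     (\<lambda>v. \<Sum>b\<in>Basis. (Y x \<bullet> b) *\<^sub>R D (\<lambda>x. T x b) x v + (D Y x v \<bullet> b) *\<^sub>R T x b)) (at x)"
    by (intro has_derivative_sum has_derivative_scaleR has_derivative_inner_left T Y)
  then have "((\<lambda>z. T z (Y z)) has_derivative
     (\<lambda>v. \<Sum>b\<in>Basis. (Y x \<bullet> b) *\<^sub>R D (\<lambda>x. T x b) x v + (D Y x v \<bullet> b) *\<^sub>R T x b)) (at x)"
    by (rule has_derivative_transform_within_open[OF _ assms(1,2)]) (rule linear_Basis_sum[symmetric], rule assms(3))
  moreover have "(\<Sum>b\<in>Basis. (Y x \<bullet> b) *\<^sub>R D (\<lambda>x. T x b) x v + (D Y x v \<bullet> b) *\<^sub>R T x b)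
     = D (\<lambda>x. T x (Y x0)) x v + T x (D Y x v)" for v
    unfolding 1 sum.distrib using linear_Basis_sum[OF assms(3)[OF assms(2)], of "D Y x v"] by simp
  ultimately show ?thesis by simp
qed

section \<open>Symmetry of second derivatives\<close>

text \<open>The mean value theorem is applied twice, along \<open>v\<close> to the first difference
  in direction \<open>w\<close> and then along \<open>w\<close>. The second difference is symmetric
  in \<open>v\<close> and \<open>w\<close> while the right-hand side is not; this asymmetry is what
  is exploited next.\<close>

lemma second_difference_mean_value:
  fixes f :: "'a::real_normed_vector \<Rightarrow> real"
  assumes h: "0 < h" and S: "\<And>s t. s \<in> {0..h} \<Longrightarrow> t \<in> {0..h} \<Longrightarrow> x + s *\<^sub>R v + t *\<^sub>R w \<in> S"
    and f: "\<And>y. y \<in> S \<Longrightarrow> f differentiable at y"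
    and fv: "\<And>y. y \<in> S \<Longrightarrow> (\<lambda>y. D f y v) differentiable at y"
  shows "\<exists>s\<in>{0..h}. \<exists>t\<in>{0..h}. f (x + h *\<^sub>R v + h *\<^sub>R w) - f (x + h *\<^sub>R v) - f (x + h *\<^sub>R w) + f x
     = h * h * D (\<lambda>y. D f y v) (x + s *\<^sub>R v + t *\<^sub>R w) w"
proof -
  have fd: "(f has_derivative D f y) (at y)" if "y \<in> S" for y
    using f[OF that] frechet_derivative_works by blast
  have fvd: "((\<lambda>y. D f y v) has_derivative D (\<lambda>y. D f y v) y) (at y)" if "y \<in> S" for y
    using fv[OF that] frechet_derivative_works by blast
  let ?G = "\<lambda>s. f (x + s *\<^sub>R v + h *\<^sub>R w) - f (x + s *\<^sub>R v)"
  have "(?G has_derivative (\<lambda>d. D f (x + s *\<^sub>R v + h *\<^sub>R w) (d *\<^sub>R v) - D f (x + s *\<^sub>R v) (d *\<^sub>R v))) (at s within {0..h})"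
    if "0 \<le> s" "s \<le> h" for s
    apply (rule has_derivative_at_withinI)
    apply (rule has_derivative_diff)
    subgoal apply (rule has_derivative_compose[of "\<lambda>s. x + s *\<^sub>R v + h *\<^sub>R w" "\<lambda>d. d *\<^sub>R v" s UNIV f, OF _ fd])
      using that h S[of s h] by (auto intro!: derivative_eq_intros)
    subgoal apply (rule has_derivative_compose[of "\<lambda>s. x + s *\<^sub>R v" "\<lambda>d. d *\<^sub>R v" s UNIV f, OF _ fd])
      using that h S[of s 0] by (auto intro!: derivative_eq_intros)
    done
  from mvt_simple[OF h this] obtain s where s: "s \<in> {0<..<h}"
    and 1: "?G h - ?G 0 = D f (x + s *\<^sub>R v + h *\<^sub>R w) (h *\<^sub>R v) - D f (x + s *\<^sub>R v) (h *\<^sub>R v)" by auto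
  have "D f (x + s *\<^sub>R v + h *\<^sub>R w) (h *\<^sub>R v) = h * D f (x + s *\<^sub>R v + h *\<^sub>R w) v"
    using linear_scale[OF has_derivative_linear[OF fd]] S[of s h] s by auto
  moreover have "D f (x + s *\<^sub>R v) (h *\<^sub>R v) = h * D f (x + s *\<^sub>R v) v"
    using linear_scale[OF has_derivative_linear[OF fd]] S[of s 0] s by auto
  ultimately have 2: "?G h - ?G 0 = h * (D f (x + s *\<^sub>R v + h *\<^sub>R w) v - D f (x + s *\<^sub>R v) v)"
    using 1 by (simp add: algebra_simps)
  have "((\<lambda>t. D f (x + s *\<^sub>R v + t *\<^sub>R w) v) has_derivative (\<lambda>d. D (\<lambda>y. D f y v) (x + s *\<^sub>R v + t *\<^sub>R w) (d *\<^sub>R w))) (at t within {0..h})"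
    if "0 \<le> t" "t \<le> h" for t
    apply (rule has_derivative_at_withinI)
    apply (rule has_derivative_compose[of "\<lambda>t. x + s *\<^sub>R v + t *\<^sub>R w" "\<lambda>d. d *\<^sub>R w" t UNIV "\<lambda>y. D f y v", OF _ fvd])
    using that s S[of s t] by (auto intro!: derivative_eq_intros)
  from mvt_simple[OF h this] obtain t where t: "t \<in> {0<..<h}"
    and 3: "D f (x + s *\<^sub>R v + h *\<^sub>R w) v - D f (x + s *\<^sub>R v) v = D (\<lambda>y. D f y v) (x + s *\<^sub>R v + t *\<^sub>R w) (h *\<^sub>R w)" by auto
  have "D (\<lambda>y. D f y v) (x + s *\<^sub>R v + t *\<^sub>R w) (h *\<^sub>R w) = h * D (\<lambda>y. D f y v) (x + s *\<^sub>R v + t *\<^sub>R w) w"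
    using linear_scale[OF has_derivative_linear[OF fvd]] S[of s t] s t by auto
  with 2 3 have "?G h - ?G 0 = h * h * D (\<lambda>y. D f y v) (x + s *\<^sub>R v + t *\<^sub>R w) w"
    by simp
  with s t show ?thesis by (intro bexI[of _ s] bexI[of _ t]) auto
qed

lemma D_commute_real:
  fixes f :: "'a::real_normed_vector \<Rightarrow> real"
  assumes "open S" "x \<in> S" "smooth_on S f"
  shows "D (\<lambda>y. D f y v) x w = D (\<lambda>y. D f y w) x v"
proof (rule ccontr)
  let ?A = "\<lambda>y. D (\<lambda>y. D f y v) y w" and ?B = "\<lambda>y. D (\<lambda>y. D f y w) y v"
  assume ne: "?A x \<noteq> ?B x"
  \<comment> \<open>Half the supposed gap: values within \<open>e\<close> of \<open>?A x\<close> and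
    values within \<open>e\<close> of \<open>?B x\<close> cannot coincide.\<close>
  define e where "e = \<bar>?A x - ?B x\<bar> / 2"
  have e: "0 < e" using ne by (simp add: e_def)
  have "isCont ?A x" "isCont ?B x"
    using smooth_on_continuous[OF smooth_on_D[OF smooth_on_D[OF assms(3)]]] assms(1,2)
    by (auto simp: continuous_on_eq_continuous_at)
  then have "\<forall>\<^sub>F y in nhds x. dist (?A y) (?A x) < e" "\<forall>\<^sub>F y in nhds x. dist (?B y) (?B x) < e"
    using e by (auto simp: continuous_at_eps_delta eventually_nhds_metric dist_commute)
  moreover have "\<forall>\<^sub>F y in nhds x. y \<in> S" using assms(1,2) by (rule eventually_nhds_in_open)
  ultimately have "\<forall>\<^sub>F y in nhds x. dist (?A y) (?A x) < e \<and> dist (?B y) (?B x) < e \<and> y \<in> S"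
    by eventually_elim auto
  then obtain d where d: "0 < d" "\<And>y. dist y x < d \<Longrightarrow> dist (?A y) (?A x) < e \<and> dist (?B y) (?B x) < e \<and> y \<in> S"
    by (auto simp: eventually_nhds_metric)
  \<comment> \<open>Small enough to keep the whole parallelogram inside the ball of radius
    \<open>d\<close>; the summand 1 covers the case where both directions vanish.\<close>
  define h where "h = d / (norm v + norm w + 1)"
  have h: "0 < h" using d by (simp add: h_def add_nonneg_pos)
  have hb: "h * (norm v + norm w) < d"
    using d by (simp add: h_def divide_simps add_nonneg_pos algebra_simps) (smt (verit) norm_ge_zero)
  have near: "dist (x + s *\<^sub>R v + t *\<^sub>R w) x < d" if "s \<in> {0..h}" "t \<in> {0..h}" for s t
  proof -
    have "norm (s *\<^sub>R v + t *\<^sub>R w) \<le> s * norm v + t * norm w"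
      using norm_triangle_ineq[of "s *\<^sub>R v" "t *\<^sub>R w"] that by simp
    also have "\<dots> \<le> h * norm v + h * norm w"
      using that by (intro add_mono mult_right_mono) auto
    finally show ?thesis using hb by (simp add: dist_norm algebra_simps)
  qed
  have df: "f differentiable at y" "(\<lambda>y. D f y z) differentiable at y" if "y \<in> S" for y z
    using smooth_on_differentiable smooth_on_D assms(3) that by blast+
  obtain s t where 1: "s \<in> {0..h}" "t \<in> {0..h}"
    "f (x + h *\<^sub>R v + h *\<^sub>R w) - f (x + h *\<^sub>R v) - f (x + h *\<^sub>R w) + f x = h * h * ?A (x + s *\<^sub>R v + t *\<^sub>R w)"
    using second_difference_mean_value[OF h, of x v w S f] near d df by blast
  have near': "dist (x + s *\<^sub>R w + t *\<^sub>R v) x < d" if "s \<in> {0..h}" "t \<in> {0..h}" for s t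
    using near[OF that(2,1)] by (simp add: algebra_simps)
  obtain s' t' where 2: "s' \<in> {0..h}" "t' \<in> {0..h}"
    "f (x + h *\<^sub>R w + h *\<^sub>R v) - f (x + h *\<^sub>R w) - f (x + h *\<^sub>R v) + f x = h * h * ?B (x + s' *\<^sub>R w + t' *\<^sub>R v)"
    using second_difference_mean_value[OF h, of x w v S f] near' d df by blast
  have "h * h * ?A (x + s *\<^sub>R v + t *\<^sub>R w) = h * h * ?B (x + s' *\<^sub>R w + t' *\<^sub>R v)"
    using 1(3) 2(3) by (simp add: algebra_simps)
  then have "?A (x + s *\<^sub>R v + t *\<^sub>R w) = ?B (x + s' *\<^sub>R w + t' *\<^sub>R v)" using h by simp
  moreover have "dist (?A (x + s *\<^sub>R v + t *\<^sub>R w)) (?A x) < e" using d(2) near 1 by blast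
  moreover have "dist (?B (x + s' *\<^sub>R w + t' *\<^sub>R v)) (?B x) < e" using d(2) near' 2 by blast
  moreover have False if "dist c a < \<bar>a - b\<bar> / 2" "dist c b < \<bar>a - b\<bar> / 2" for a b c :: real
    using that by (auto simp: dist_real_def abs_if split: if_splits)
  ultimately show False unfolding e_def by metis
qed

text \<open>Proved component by component. The symmetry enters the geometry twice: as d(d\<eta>) =
  0, and as naturality of the Lie bracket under chart changes.\<close>

lemma D_commute:
  fixes f :: "'a::real_normed_vector \<Rightarrow> 'b::euclidean_space"
  assumes "open S" "x \<in> S" "smooth_on S f"
  shows "D (\<lambda>y. D f y v) x w = D (\<lambda>y. D f y w) x v"
proof (rule euclidean_eqI)
  fix b :: 'b
  have 1: "D (\<lambda>y. f y \<bullet> b) y z = D f y z \<bullet> b" if "y \<in> S" for y z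
    by (rule D_eqI) (intro has_derivative_inner_left smooth_on_has_derivative[OF assms(3) that])
  have 2: "D (\<lambda>y. D (\<lambda>y. f y \<bullet> b) y z) x z' = D (\<lambda>y. D f y z) x z' \<bullet> b" for z z'
  proof (rule D_eqI)
    have "((\<lambda>y. D f y z \<bullet> b) has_derivative (\<lambda>z'. D (\<lambda>y. D f y z) x z' \<bullet> b)) (at x)"
      by (intro has_derivative_inner_left smooth_on_has_derivative[OF smooth_on_D[OF assms(3)] assms(2)])
    then show "((\<lambda>y. D (\<lambda>y. f y \<bullet> b) y z) has_derivative (\<lambda>z'. D (\<lambda>y. D f y z) x z' \<bullet> b)) (at x)"
      by (rule has_derivative_transform_within_open[OF _ assms(1,2)]) (simp add: 1)
  qed
  show "D (\<lambda>y. D f y v) x w \<bullet> b = D (\<lambda>y. D f y w) x v \<bullet> b"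
    using D_commute_real[OF assms(1,2) smooth_on_linear[OF bounded_linear_inner_left assms(1,3)], of b v w]
    unfolding 2 .
qed

section \<open>Local paracontact geometry\<close>

lemma smooth_on_bracket:
  assumes "open S" "smooth_on S X" "smooth_on S Y"
  shows "smooth_on S (bracket X Y)"
proof -
  have "linear (D X x)" "linear (D Y x)" if "x \<in> S" for x
    using assms smooth_on_has_derivative has_derivative_linear that by blast+
  then have "smooth_on S (\<lambda>x. D Y x (X x) - D X x (Y x))"
    using smooth_on_app[OF assms(1), of "D Y" X] smooth_on_app[OF assms(1), of "D X" Y] assms
    by (simp add: smooth_on_diff smooth_on_D)
  then show ?thesis by (simp add: bracket_def[abs_def] along_def)
qed

lemma D_cong_open:
  assumes "open S" "u \<in> S" "\<And>x. x \<in> S \<Longrightarrow> f x = g x" "g differentiable at u"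
  shows "D f u v = D g u v"
  using frechet_derivative_transform_within_open[OF assms(4,1,2), of f] assms(3) by simp

lemma bracket_cong:
  assumes "open S" "u \<in> S" "\<And>x. x \<in> S \<Longrightarrow> X x = X' x" "\<And>x. x \<in> S \<Longrightarrow> Y x = Y' x"
    "X' differentiable at u" "Y' differentiable at u"
  shows "bracket X Y u = bracket X' Y' u"
  unfolding bracket_def along_def
  using D_cong_open[OF assms(1-3,5)] D_cong_open[OF assms(1,2,4,6)] assms(2,3,4) by simp

lemma bracket_minus_right:
  assumes "X differentiable at u" "Y differentiable at u"
  shows "bracket X (\<lambda>x. - Y x) u = - bracket X Y u"
  using D_eqI[OF has_derivative_minus[OF assms(2)[unfolded frechet_derivative_works]]]
    linear_neg[OF linear_frechet_derivative[OF assms(1)]]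
  by (simp add: bracket_def along_def)

lemma bracket_scaleR_right:
  assumes "f differentiable at u" "X differentiable at u" "Y differentiable at u"
  shows "bracket X (\<lambda>x. f x *\<^sub>R Y x) u = f u *\<^sub>R bracket X Y u + D f u (X u) *\<^sub>R Y u"
  using D_eqI[OF has_derivative_scaleR[OF assms(1)[unfolded frechet_derivative_works]
        assms(3)[unfolded frechet_derivative_works]]]
    linear_scale[OF linear_frechet_derivative[OF assms(2)]]
  by (simp add: bracket_def along_def algebra_simps)

lemma bracket_swap: "bracket X Y u = - bracket Y X u"
  by (simp add: bracket_def)

lemma has_derivative_bilinear_app:
  fixes B :: "real^3 \<Rightarrow> real^3 \<Rightarrow> real^3 \<Rightarrow> 'c::real_normed_vector"
  assumes "open S" "u \<in> S" "\<And>x. x \<in> S \<Longrightarrow> bilinear (B x)" "\<And>v w. smooth_on S (\<lambda>x. B x v w)"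
    "Y differentiable at u" "Z differentiable at u"
  shows "((\<lambda>x. B x (Y x) (Z x)) has_derivative
     (\<lambda>v. D (\<lambda>x. B x (Y u) (Z u)) u v + B u (D Y u v) (Z u) + B u (Y u) (D Z u v))) (at u)"
proof -
  have 1: "((\<lambda>x. B x (Y x) z) has_derivative (\<lambda>v. D (\<lambda>x. B x (Y u) z) u v + B u (D Y u v) z)) (at u)" for z
    using assms(3,5) smooth_on_differentiable[OF assms(4,2)]
    by (intro has_derivative_app[OF assms(1,2), where T = "\<lambda>x y. B x y z"]) (auto simp: bilinear_def)
  have 2: "(\<lambda>x. B x (Y x) z) differentiable at u" for z
    using 1 differentiable_def by blast
  have "((\<lambda>x. B x (Y x) (Z x)) has_derivative (\<lambda>v. D (\<lambda>x. B x (Y x) (Z u)) u v + B u (Y u) (D Z u v))) (at u)"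
    using assms(3,6) 2
    by (intro has_derivative_app[OF assms(1,2), where T = "\<lambda>x z. B x (Y x) z"]) (auto simp: bilinear_def)
  then show ?thesis by (simp add: D_eqI[OF 1])
qed

lemma smooth_on_bilinear_app:
  fixes B :: "real^3 \<Rightarrow> real^3 \<Rightarrow> real^3 \<Rightarrow> 'c::real_normed_vector"
  assumes "open S" "\<And>x. x \<in> S \<Longrightarrow> bilinear (B x)" "\<And>v w. smooth_on S (\<lambda>x. B x v w)"
    "smooth_on S Y" "smooth_on S Z"
  shows "smooth_on S (\<lambda>x. B x (Y x) (Z x))"
proof (rule smooth_on_app[OF assms(1) _ _ assms(5)])
  show "linear (B x (Y x))" if "x \<in> S" for x
    using assms(2)[OF that] by (simp add: bilinear_def)
  have "linear (\<lambda>y. B x y z)" if "x \<in> S" for x z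
    using assms(2)[OF that] by (simp add: bilinear_def)
  then show "smooth_on S (\<lambda>x. B x (Y x) z)" for z
    using smooth_on_app[OF assms(1), of "\<lambda>x y. B x y z" Y] assms(3,4) by simp
qed

lemma nabla_cong:
  assumes "open S" "u \<in> S" "\<And>x. x \<in> S \<Longrightarrow> Y x = Y' x" "Y' differentiable at u"
  shows "nabla \<Gamma> X Y u = nabla \<Gamma> X Y' u"
  unfolding nabla_def along_def using D_cong_open[OF assms] assms(2,3) by simp

section \<open>Structure tensors and connection on one coordinate domain\<close>

locale paracontact_chart =
  fixes W :: "(real^3) set" and \<phi> :: tensor11 and \<xi> :: vfield and \<eta> :: form1 and g :: tensor02
    and \<Gamma> :: connection and \<kappa> \<mu> :: real
  assumes open_W: "open W"
    and phi_linear: "u \<in> W \<Longrightarrow> linear (\<phi> u)" and phi_smooth: "smooth_on W (\<lambda>u. \<phi> u v)"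
    and xi_smooth: "smooth_on W \<xi>"
    and eta_linear: "u \<in> W \<Longrightarrow> linear (\<eta> u)" and eta_smooth: "smooth_on W (\<lambda>u. \<eta> u v)"
    and g_bilinear: "u \<in> W \<Longrightarrow> bilinear (g u)" and g_smooth: "smooth_on W (\<lambda>u. g u v w)"
    and g_sym: "u \<in> W \<Longrightarrow> g u v w = g u w v"
    and g_nondegenerate: "u \<in> W \<Longrightarrow> (\<And>w. g u v w = 0) \<Longrightarrow> v = 0"
    and phi_phi: "u \<in> W \<Longrightarrow> \<phi> u (\<phi> u v) = v - \<eta> u v *\<^sub>R \<xi> u"
    and eta_xi: "u \<in> W \<Longrightarrow> \<eta> u (\<xi> u) = 1"
    and g_phi_phi: "u \<in> W \<Longrightarrow> g u (\<phi> u v) (\<phi> u w) = - g u v w + \<eta> u v * \<eta> u w"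
    and d_eta: "smooth_on W X \<Longrightarrow> smooth_on W Y \<Longrightarrow> u \<in> W \<Longrightarrow> d1 \<eta> X Y u = g u (X u) (\<phi> u (Y u))"
    and levi_civita: "levi_civita W g \<Gamma>"
    and curvature_xi: "smooth_on W X \<Longrightarrow> smooth_on W Y \<Longrightarrow> u \<in> W \<Longrightarrow>
      curvature \<Gamma> X Y \<xi> u = \<kappa> *\<^sub>R (\<eta> u (Y u) *\<^sub>R X u - \<eta> u (X u) *\<^sub>R Y u) +
        \<mu> *\<^sub>R (\<eta> u (Y u) *\<^sub>R h_tensor \<phi> \<xi> X u - \<eta> u (X u) *\<^sub>R h_tensor \<phi> \<xi> Y u)"
begin

lemma Gamma_bilinear: "u \<in> W \<Longrightarrow> bilinear (\<Gamma> u)"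
  and Gamma_smooth: "smooth_on W (\<lambda>u. \<Gamma> u v w)"
  using levi_civita unfolding levi_civita_def by auto

lemmas phi_simps = linear_0[OF phi_linear] linear_add[OF phi_linear] linear_diff[OF phi_linear]
  linear_neg[OF phi_linear] linear_scale[OF phi_linear]
lemmas eta_simps = linear_0[OF eta_linear] linear_add[OF eta_linear] linear_diff[OF eta_linear]
  linear_neg[OF eta_linear] linear_scale[OF eta_linear]
lemmas g_simps = bilinear_lzero[OF g_bilinear] bilinear_rzero[OF g_bilinear]
  bilinear_ladd[OF g_bilinear] bilinear_radd[OF g_bilinear]
  bilinear_lsub[OF g_bilinear] bilinear_rsub[OF g_bilinear]
  bilinear_lneg[OF g_bilinear] bilinear_rneg[OF g_bilinear]
  bilinear_lmul[OF g_bilinear] bilinear_rmul[OF g_bilinear]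
lemmas Gamma_simps = bilinear_lzero[OF Gamma_bilinear] bilinear_rzero[OF Gamma_bilinear]
  bilinear_ladd[OF Gamma_bilinear] bilinear_radd[OF Gamma_bilinear]
  bilinear_lsub[OF Gamma_bilinear] bilinear_rsub[OF Gamma_bilinear]
  bilinear_lneg[OF Gamma_bilinear] bilinear_rneg[OF Gamma_bilinear]
  bilinear_lmul[OF Gamma_bilinear] bilinear_rmul[OF Gamma_bilinear]

text \<open>A vector killed by \<phi>^2 is a multiple of \<xi>. Since \<phi>^2 \<xi> = 0, this
  applies to \<phi> \<xi>, say \<phi> \<xi> = a \<xi>; then a^2 \<xi> = 0 forces a = 0.\<close>

lemma phi_xi: assumes u: "u \<in> W" shows "\<phi> u (\<xi> u) = 0"
proof -
  have 0: "\<phi> u (\<phi> u (\<xi> u)) = 0" using phi_phi[OF u, of "\<xi> u"] eta_xi[OF u] by simp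
  define a where "a = \<eta> u (\<phi> u (\<xi> u))"
  have 1: "\<phi> u (\<xi> u) = a *\<^sub>R \<xi> u"
    using phi_phi[OF u, of "\<phi> u (\<xi> u)"] 0 phi_simps(1)[OF u] by (simp add: a_def)
  have "(a * a) *\<^sub>R \<xi> u = 0" using 0 unfolding 1 by (simp add: phi_simps[OF u] 1)
  moreover have "\<xi> u \<noteq> 0" using eta_xi[OF u] eta_simps(1)[OF u] by auto
  ultimately show ?thesis using 1 by simp
qed

text \<open>From \<phi> \<xi> = 0 follows \<phi>^3 = \<phi>; comparison with the formula for
  \<phi>^2 at \<phi> v leaves only the multiple of \<xi>, which must vanish.\<close>

lemma eta_phi: assumes u: "u \<in> W" shows "\<eta> u (\<phi> u v) = 0"
proof -
  have "\<phi> u (\<phi> u (\<phi> u v)) = \<phi> u v"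
    by (subst phi_phi[OF u, of v]) (simp add: phi_simps[OF u] phi_xi[OF u])
  then have "\<eta> u (\<phi> u v) *\<^sub>R \<xi> u = 0" using phi_phi[OF u, of "\<phi> u v"] by simp
  moreover have "\<xi> u \<noteq> 0" using eta_xi[OF u] eta_simps(1)[OF u] by auto
  ultimately show ?thesis by simp
qed

lemma g_xi: assumes u: "u \<in> W" shows "g u v (\<xi> u) = \<eta> u v" "g u (\<xi> u) v = \<eta> u v"
  using g_phi_phi[OF u, of v "\<xi> u"] g_sym[OF u] by (simp_all add: phi_xi[OF u] eta_xi[OF u] g_simps[OF u])

text \<open>The compatibility condition with \<open>w\<close> replaced by \<phi> w. It says that the
  fundamental form is skew.\<close>

lemma g_phi: assumes u: "u \<in> W" shows "g u v (\<phi> u w) = - g u (\<phi> u v) w"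
  using g_phi_phi[OF u, of v "\<phi> u w"]
  by (simp add: phi_phi[OF u] eta_phi[OF u] g_simps[OF u] g_xi[OF u])

text \<open>Nullity comes from g(x,x) = s^2 g(x,x) = g(\<phi> x, \<phi> x) = - g(x,x), once \<eta>
  is known to kill x.\<close>

lemma eigenvector:
  assumes u: "u \<in> W" and "\<phi> u x = s *\<^sub>R x" "s = 1 \<or> s = -1"
  shows "\<eta> u x = 0" "g u x x = 0"
proof -
  show 1: "\<eta> u x = 0" using eta_phi[OF u, of x] assms(2,3) by (auto simp: eta_simps[OF u])
  show "g u x x = 0" using g_phi_phi[OF u, of x x] assms(2,3) 1 by (auto simp: g_simps[OF u])
qed

text \<open>Constant fields have vanishing bracket, so testing on them isolates the Christoffel
  part. \<open>torsion\<close> then holds for arbitrary fields, also those given only on a smaller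
  open set; \<open>D_g\<close> and \<open>metric\<close> repeat the pattern for metric
  compatibility.\<close>

lemma Gamma_sym: assumes u: "u \<in> W" shows "\<Gamma> u v w = \<Gamma> u w v"
proof -
  have "nabla \<Gamma> (\<lambda>_. v) (\<lambda>_. w) u - nabla \<Gamma> (\<lambda>_. w) (\<lambda>_. v) u = bracket (\<lambda>_. v) (\<lambda>_. w) u"
    using levi_civita u smooth_on_const unfolding levi_civita_def by blast
  then show ?thesis by (simp add: nabla_def bracket_def along_def)
qed

lemma torsion: "u \<in> W \<Longrightarrow> nabla \<Gamma> X Y u - nabla \<Gamma> Y X u = bracket X Y u"
  using Gamma_sym[of u "X u" "Y u"] by (simp add: nabla_def bracket_def along_def)

lemma D_g: assumes u: "u \<in> W"
  shows "D (\<lambda>x. g x y z) u v = g u (\<Gamma> u v y) z + g u y (\<Gamma> u v z)"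
proof -
  have "along (\<lambda>_. v) (\<lambda>u. g u y z) u = g u (nabla \<Gamma> (\<lambda>_. v) (\<lambda>_. y) u) z + g u y (nabla \<Gamma> (\<lambda>_. v) (\<lambda>_. z) u)"
    using levi_civita u smooth_on_const[of W] unfolding levi_civita_def by blast
  then show ?thesis by (simp add: nabla_def along_def)
qed

lemma metric:
  assumes u: "u \<in> W" and "Y differentiable at u" "Z differentiable at u"
  shows "D (\<lambda>x. g x (Y x) (Z x)) u (X u) = g u (nabla \<Gamma> X Y u) (Z u) + g u (Y u) (nabla \<Gamma> X Z u)"
  using D_eqI[OF has_derivative_bilinear_app[OF open_W u g_bilinear g_smooth assms(2,3)]] D_g[OF u]
  by (simp add: nabla_def along_def g_simps[OF u])

lemma D_eta: assumes u: "u \<in> W"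
  shows "D (\<lambda>x. \<eta> x w) u v - D (\<lambda>x. \<eta> x v) u w = 2 * g u v (\<phi> u w)"
  using d_eta[OF smooth_on_const smooth_on_const u, of v w]
  by (simp add: d1_def app_def[abs_def] along_def bracket_def eta_simps[OF u])

lemma has_derivative_eta:
  assumes "u \<in> W" "Y differentiable at u"
  shows "((\<lambda>x. \<eta> x (Y x)) has_derivative (\<lambda>v. D (\<lambda>x. \<eta> x (Y u)) u v + \<eta> u (D Y u v))) (at u)"
  using assms by (intro has_derivative_app[OF open_W])
    (auto intro: eta_linear smooth_on_differentiable[OF eta_smooth])

lemma has_derivative_phi:
  assumes "u \<in> W" "Y differentiable at u"
  shows "((\<lambda>x. \<phi> x (Y x)) has_derivative (\<lambda>v. D (\<lambda>x. \<phi> x (Y u)) u v + \<phi> u (D Y u v))) (at u)"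
  using assms by (intro has_derivative_app[OF open_W])
    (auto intro: phi_linear smooth_on_differentiable[OF phi_smooth])

lemma d1_eq:
  assumes u: "u \<in> W" and "X differentiable at u" "Y differentiable at u"
  shows "d1 \<eta> X Y u = g u (X u) (\<phi> u (Y u))"
  using D_eqI[OF has_derivative_eta[OF u assms(2)]] D_eqI[OF has_derivative_eta[OF u assms(3)]]
    D_eta[OF u, of "Y u" "X u"]
  by (simp add: d1_def app_def[abs_def] along_def bracket_def eta_simps[OF u])

text \<open>This is d\<Phi> = 0 on constant fields: \<Phi> = d\<eta> has coefficients that are
  antisymmetrised first derivatives of \<eta>, and in the cyclic sum the six second derivatives
  cancel in pairs.\<close>

lemma D_fundamental_cyclic:
  assumes u: "u \<in> W"
  shows "D (\<lambda>x. g x v (\<phi> x w)) u z + D (\<lambda>x. g x w (\<phi> x z)) u v + D (\<lambda>x. g x z (\<phi> x v)) u w = 0"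
proof -
  have *: "D (\<lambda>y. g y a (\<phi> y b)) u c = 1/2 * (D (\<lambda>y. D (\<lambda>x. \<eta> x b) y a) u c - D (\<lambda>y. D (\<lambda>x. \<eta> x a) y b) u c)" for a b c
  proof -
    have "((\<lambda>y. 1/2 * (D (\<lambda>x. \<eta> x b) y a - D (\<lambda>x. \<eta> x a) y b)) has_derivative
      (\<lambda>c. 1/2 * (D (\<lambda>y. D (\<lambda>x. \<eta> x b) y a) u c - D (\<lambda>y. D (\<lambda>x. \<eta> x a) y b) u c))) (at u)"
      by (intro has_derivative_mult_right has_derivative_diff
          smooth_on_has_derivative[OF smooth_on_D[OF eta_smooth] u])
    then have "((\<lambda>y. g y a (\<phi> y b)) has_derivative
      (\<lambda>c. 1/2 * (D (\<lambda>y. D (\<lambda>x. \<eta> x b) y a) u c - D (\<lambda>y. D (\<lambda>x. \<eta> x a) y b) u c))) (at u)"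
      by (rule has_derivative_transform_within_open[OF _ open_W u]) (simp add: D_eta)
    then show ?thesis by (rule D_eqI)
  qed
  have c: "D (\<lambda>y. D (\<lambda>x. \<eta> x a) y b) u c = D (\<lambda>y. D (\<lambda>x. \<eta> x a) y c) u b" for a b c
    by (rule D_commute[OF open_W u eta_smooth])
  show ?thesis using c[of w v z] c[of v w z] c[of z w v] unfolding * by (simp add: diff_divide_distrib)
qed

lemma D_phi_linear: assumes u: "u \<in> W" shows "linear (\<lambda>a. D (\<lambda>x. \<phi> x a) u v)"
proof (rule linearI)
  note d = smooth_on_has_derivative[OF phi_smooth u]
  show "D (\<lambda>x. \<phi> x (a + b)) u v = D (\<lambda>x. \<phi> x a) u v + D (\<lambda>x. \<phi> x b) u v" for a b
    by (rule D_eqI, rule has_derivative_transform_within_open[OF has_derivative_add[OF d d] open_W u])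
      (simp add: phi_simps)
  show "D (\<lambda>x. \<phi> x (c *\<^sub>R a)) u v = c *\<^sub>R D (\<lambda>x. \<phi> x a) u v" for c a
    by (rule D_eqI, rule has_derivative_transform_within_open[OF has_derivative_scaleR_right[OF d] open_W u])
      (simp add: phi_simps)
qed

text \<open>The derivative of \<open>X\<close> along \<xi> enters both brackets through \<phi> and
  cancels, so only the value of \<open>X\<close> at the point remains.\<close>

lemma h_tensorial:
  assumes u: "u \<in> W" and "X differentiable at u"
  shows "h_tensor \<phi> \<xi> X u = (1/2) *\<^sub>R (D (\<lambda>x. \<phi> x (X u)) u (\<xi> u) - D \<xi> u (\<phi> u (X u)) + \<phi> u (D \<xi> u (X u)))"
  using D_eqI[OF has_derivative_phi[OF u assms(2)]]
  by (simp add: h_tensor_def lie_derivative_def bracket_def along_def app_def[abs_def] phi_simps[OF u])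

text \<open>The hypotheses quantify over fields on the whole chart domain. Tensoriality reduces them to constant
  fields, and so carries them over to frames that exist only on a smaller open set.\<close>

lemma curvature_tensorial:
  assumes u: "u \<in> W" and "X differentiable at u" "Y differentiable at u" and Z: "smooth_on W Z"
  shows "curvature \<Gamma> X Y Z u = curvature \<Gamma> (\<lambda>_. X u) (\<lambda>_. Y u) Z u"
proof -
  \<comment> \<open>\<open>?T x\<close> is the endomorphism \<open>y\<close> to nabla_y Z at
    \<open>x\<close>. Its smoothness needs \<open>Z\<close> on all of \<open>W\<close>, whereas
    \<open>X\<close> and \<open>Y\<close> are only required to be differentiable at the
    point.\<close>
  let ?T = "\<lambda>x y. D Z x y + \<Gamma> x y (Z x)"
  have lin: "linear (?T x)" if "x \<in> W" for x
    using has_derivative_linear[OF smooth_on_has_derivative[OF Z that]] Gamma_bilinear[OF that]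
    by (intro linear_compose_add) (auto simp: bilinear_def)
  have sm: "smooth_on W (\<lambda>x. ?T x v)" for v
    by (intro smooth_on_add[OF open_W] smooth_on_D[OF Z]
        smooth_on_bilinear_app[OF open_W Gamma_bilinear Gamma_smooth smooth_on_const Z])
  have 1: "D (\<lambda>x. ?T x (Y x)) u v = D (\<lambda>x. ?T x (Y u)) u v + ?T u (D Y u v)" if "Y differentiable at u" for Y v
    by (rule D_eqI, rule has_derivative_app[OF open_W u lin])
      (use that smooth_on_differentiable[OF sm u] in auto)
  have 2: "D (nabla \<Gamma> Y Z) u v = D (\<lambda>x. ?T x (Y u)) u v + ?T u (D Y u v)" if "Y differentiable at u" for Y v
    using 1[OF that] by (simp add: nabla_def[abs_def] along_def)
  \<comment> \<open>The terms containing derivatives of \<open>X\<close> and \<open>Y\<close> are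
    exactly those of the covariant derivative along the bracket, and cancel.\<close>
  have 3: "curvature \<Gamma> X Y Z u = D (\<lambda>x. ?T x (Y u)) u (X u) - D (\<lambda>x. ?T x (X u)) u (Y u)
      + \<Gamma> u (X u) (?T u (Y u)) - \<Gamma> u (Y u) (?T u (X u))"
    if "X differentiable at u" "Y differentiable at u" for X Y
  proof -
    have "nabla \<Gamma> (bracket X Y) Z u = ?T u (D Y u (X u)) - ?T u (D X u (Y u))"
      using linear_diff[OF lin[OF u]] by (simp add: nabla_def along_def bracket_def)
    moreover have "nabla \<Gamma> X (nabla \<Gamma> Y Z) u =
        D (\<lambda>x. ?T x (Y u)) u (X u) + ?T u (D Y u (X u)) + \<Gamma> u (X u) (?T u (Y u))"
      using 2[OF that(2), of "X u"] by (simp add: nabla_def along_def)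
    moreover have "nabla \<Gamma> Y (nabla \<Gamma> X Z) u =
        D (\<lambda>x. ?T x (X u)) u (Y u) + ?T u (D X u (Y u)) + \<Gamma> u (Y u) (?T u (X u))"
      using 2[OF that(1), of "Y u"] by (simp add: nabla_def along_def)
    ultimately show ?thesis unfolding curvature_def by (simp add: algebra_simps)
  qed
  show ?thesis using 3[OF assms(2,3)] 3[of "\<lambda>_. X u" "\<lambda>_. Y u"] by simp
qed

lemma curvature_eq:
  assumes u: "u \<in> W" and X: "X differentiable at u" and Y: "Y differentiable at u"
  shows "curvature \<Gamma> X Y \<xi> u = \<kappa> *\<^sub>R (\<eta> u (Y u) *\<^sub>R X u - \<eta> u (X u) *\<^sub>R Y u) +
        \<mu> *\<^sub>R (\<eta> u (Y u) *\<^sub>R h_tensor \<phi> \<xi> X u - \<eta> u (X u) *\<^sub>R h_tensor \<phi> \<xi> Y u)"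
  unfolding curvature_tensorial[OF u X Y xi_smooth] curvature_xi[OF smooth_on_const smooth_on_const u]
  by (simp add: h_tensorial[OF u X] h_tensorial[OF u Y] h_tensorial[OF u differentiable_const])

text \<open>All derivatives of \<open>X\<close> and \<open>Y\<close> cancel among the four brackets,
  leaving derivatives of \<phi> with frozen arguments; d\<eta> is replaced by the fundamental form.
  Normality can thus be tested on a frame at one point.\<close>

lemma normality_tensorial:
  assumes u: "u \<in> W" and X: "X differentiable at u" and Y: "Y differentiable at u"
  shows "normality_tensor \<phi> \<xi> \<eta> X Y u =
    D (\<lambda>x. \<phi> x (Y u)) u (\<phi> u (X u)) - D (\<lambda>x. \<phi> x (X u)) u (\<phi> u (Y u))
    + \<phi> u (D (\<lambda>x. \<phi> x (X u)) u (Y u)) - \<phi> u (D (\<lambda>x. \<phi> x (Y u)) u (X u))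
    - (2 * g u (X u) (\<phi> u (Y u))) *\<^sub>R \<xi> u"
  using D_eqI[OF has_derivative_phi[OF u X]] D_eqI[OF has_derivative_phi[OF u Y]]
  by (simp add: normality_tensor_def nijenhuis_def d1_eq[OF u X Y] bracket_def along_def
      app_def[abs_def] phi_simps[OF u])

end

section \<open>Adapted null frames, their structure functions and curvature\<close>

locale local_frame = paracontact_chart +
  fixes V :: "(real^3) set" and E1 E2 :: vfield
  assumes open_V: "open V" and V_W: "V \<subseteq> W"
    and E1_smooth: "smooth_on V E1" and E2_smooth: "smooth_on V E2"
    and phi_E1: "u \<in> V \<Longrightarrow> \<phi> u (E1 u) = E1 u" and phi_E2: "u \<in> V \<Longrightarrow> \<phi> u (E2 u) = - E2 u"
    and g_E1_E2: "u \<in> V \<Longrightarrow> g u (E1 u) (E2 u) = 1"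
begin

lemma W: "u \<in> V \<Longrightarrow> u \<in> W" using V_W by blast

text \<open>Orthogonality to \<xi> and nullity are forced by the eigenvector equations for \<phi>,
  so the locale lists only these and the normalisation.\<close>

lemma gram:
  assumes u: "u \<in> V"
  shows "\<eta> u (E1 u) = 0" "\<eta> u (E2 u) = 0" "g u (E1 u) (E1 u) = 0" "g u (E2 u) (E2 u) = 0"
    "g u (E2 u) (E1 u) = 1" "g u (E1 u) (E2 u) = 1"
  using eigenvector[OF W[OF u], of "E1 u" 1] eigenvector[OF W[OF u], of "E2 u" "-1"]
    phi_E1[OF u] phi_E2[OF u] g_E1_E2[OF u] g_sym[OF W[OF u], of "E1 u" "E2 u"] by simp_all

text \<open>Pairing a vanishing combination with \<eta>, \<open>E1\<close> and \<open>E2\<close>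
  kills each coefficient, because the Gram matrix is invertible; in dimension three an injective
  linear map is onto.\<close>

lemma frame_combination:
  assumes u: "u \<in> V"
  shows "\<exists>a b c. x = a *\<^sub>R \<xi> u + b *\<^sub>R E1 u + c *\<^sub>R E2 u"
proof -
  let ?L = "\<lambda>y :: real^3. (y $ 1) *\<^sub>R \<xi> u + (y $ 2) *\<^sub>R E1 u + (y $ 3) *\<^sub>R E2 u"
  have lin: "linear ?L" by (intro linearI) (simp_all add: algebra_simps)
  have "y = 0" if 0: "?L y = 0" for y
  proof -
    have "\<eta> u (?L y) = 0" "g u (?L y) (E1 u) = 0" "g u (?L y) (E2 u) = 0"
      unfolding 0 using eta_simps(1)[OF W[OF u]] g_simps(1)[OF W[OF u]] by auto
    then have "y $ 1 = 0" "y $ 2 = 0" "y $ 3 = 0"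
      by (simp_all add: eta_simps[OF W[OF u]] g_simps[OF W[OF u]] gram[OF u] g_xi[OF W[OF u]] eta_xi[OF W[OF u]])
    then show ?thesis by (simp add: vec_eq_iff forall_3)
  qed
  then have "inj ?L" using linear_injective_0[OF lin] by blast
  then have "surj ?L" by (rule linear_injective_imp_surjective[OF lin]) auto
  then show ?thesis using surjD[of ?L x] by blast
qed

lemma frame_span: "u \<in> V \<Longrightarrow> span {\<xi> u, E1 u, E2 u} = UNIV"
proof -
  assume u: "u \<in> V"
  have "x \<in> span {\<xi> u, E1 u, E2 u}" for x
  proof -
    obtain a b c where "x = a *\<^sub>R \<xi> u + b *\<^sub>R E1 u + c *\<^sub>R E2 u" using frame_combination[OF u] by blast
    then show ?thesis by (auto intro!: span_add span_scale intro: span_base)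
  qed
  then show ?thesis by auto
qed

text \<open>Nondegeneracy of the metric, with \<eta> as pairing with \<xi>. Vector identities below
  are checked through these three numbers.\<close>

lemma vec_eqI:
  assumes u: "u \<in> V" and "\<eta> u x = \<eta> u y" "g u x (E1 u) = g u y (E1 u)" "g u x (E2 u) = g u y (E2 u)"
  shows "x = y"
proof -
  have "g u (x - y) w = 0" for w
    using frame_combination[OF u, of w] assms(2-4)
    by (auto simp: g_simps[OF W[OF u]] g_xi[OF W[OF u]])
  then have "x - y = 0" by (rule g_nondegenerate[OF W[OF u]])
  then show ?thesis by simp
qed

lemma expand:
  assumes u: "u \<in> V"
  shows "x = \<eta> u x *\<^sub>R \<xi> u + g u x (E2 u) *\<^sub>R E1 u + g u x (E1 u) *\<^sub>R E2 u"
  by (rule vec_eqI[OF u])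
    (simp_all add: eta_simps[OF W[OF u]] g_simps[OF W[OF u]] gram[OF u] g_xi[OF W[OF u]] eta_xi[OF W[OF u]])

lemma frame_differentiable:
  assumes "u \<in> V"
  shows "E1 differentiable at u" "E2 differentiable at u" "\<xi> differentiable at u"
  using assms W smooth_on_differentiable E1_smooth E2_smooth xi_smooth by blast+

text \<open>The frame vectors are null with product 1, so the coefficient along \<open>E1\<close> is
  read off by pairing with \<open>E2\<close> and vice versa. These five functions are the
  \<open>p\<close>, \<open>q\<close>, \<open>r\<close>, \<open>a\<close>, \<open>b\<close> of the
  overview; the sign in \<open>c\<^sub>b\<close> matches the term - b E2.\<close>

definition "c\<^sub>p x = g x (bracket \<xi> E1 x) (E2 x)"
definition "c\<^sub>q x = g x (bracket \<xi> E1 x) (E1 x)"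
definition "c\<^sub>r x = g x (bracket \<xi> E2 x) (E2 x)"
definition "c\<^sub>a x = g x (bracket E1 E2 x) (E2 x)"
definition "c\<^sub>b x = - g x (bracket E1 E2 x) (E1 x)"

lemma structure_smooth: "smooth_on V c\<^sub>q" "smooth_on V c\<^sub>r" "smooth_on V c\<^sub>a" "smooth_on V c\<^sub>b"
proof -
  have *: "smooth_on V (\<lambda>x. g x (bracket X Y x) (Z x))"
    if "smooth_on V X" "smooth_on V Y" "smooth_on V Z" for X Y Z
    by (rule smooth_on_bilinear_app[OF open_V g_bilinear[OF W] smooth_on_subset[OF g_smooth V_W]
        smooth_on_bracket[OF open_V that(1,2)] that(3)])
  note xi = smooth_on_subset[OF xi_smooth V_W]
  show "smooth_on V c\<^sub>q" "smooth_on V c\<^sub>r" "smooth_on V c\<^sub>a" "smooth_on V c\<^sub>b"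
    using *[OF xi E1_smooth E1_smooth] *[OF xi E2_smooth E2_smooth] *[OF E1_smooth E2_smooth E2_smooth]
      smooth_on_minus[OF open_V *[OF E1_smooth E2_smooth E1_smooth]]
    by (simp_all add: c\<^sub>q_def[abs_def] c\<^sub>r_def[abs_def] c\<^sub>a_def[abs_def] c\<^sub>b_def[abs_def])
qed

lemma D_locally_const:
  fixes c :: "'b::real_normed_vector"
  assumes "u \<in> V" "\<And>x. x \<in> V \<Longrightarrow> f x = c" shows "D f u v = 0"
  using D_cong_open[OF open_V assms(1), of f "\<lambda>_. c" v] assms(2) by simp

lemma metric_const:
  assumes u: "u \<in> V" and "Y differentiable at u" "Z differentiable at u" "\<And>x. x \<in> V \<Longrightarrow> g x (Y x) (Z x) = c"
  shows "g u (nabla \<Gamma> X Y u) (Z u) + g u (nabla \<Gamma> X Z u) (Y u) = 0"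
  using metric[OF W[OF u] assms(2,3), of X] D_locally_const[OF u, of "\<lambda>x. g x (Y x) (Z x)" c "X u", OF assms(4)]
    g_sym[OF W[OF u]] by simp

text \<open>\<eta> is constant on the three frame fields, so 2 d\<eta>(X,Y) reduces to -
  \<eta>[X,Y]. The value 2 is -2 g(E1, \<phi> E2).\<close>

lemma eta_bracket:
  assumes u: "u \<in> V"
  shows "\<eta> u (bracket \<xi> E1 u) = 0" "\<eta> u (bracket \<xi> E2 u) = 0" "\<eta> u (bracket E1 E2 u) = 2"
proof -
  have 1: "D (app \<eta> E1) u v = 0" "D (app \<eta> E2) u v = 0" "D (app \<eta> \<xi>) u v = 0" for v
    by (rule D_locally_const[OF u]; simp add: app_def gram eta_xi W)+
  note d = frame_differentiable[OF u]
  show "\<eta> u (bracket \<xi> E1 u) = 0" "\<eta> u (bracket \<xi> E2 u) = 0" "\<eta> u (bracket E1 E2 u) = 2"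
    using d1_eq[OF W[OF u] d(3,1)] d1_eq[OF W[OF u] d(3,2)] d1_eq[OF W[OF u] d(1,2)]
    by (simp_all add: d1_def along_def 1 g_phi[OF W[OF u]] phi_xi[OF W[OF u]] phi_E1[OF u]
      gram[OF u] g_xi[OF W[OF u]] g_simps[OF W[OF u]])
qed

text \<open>Where \<Phi>(Y,Z) is constant, the derivative of the coefficients of \<Phi> can be
  traded for derivatives of the fields. Skewness of \<Phi> puts \<phi> on the first argument in the
  second term.\<close>

lemma D_fundamental:
  assumes u: "u \<in> V" and "Y differentiable at u" "Z differentiable at u" "\<And>x. x \<in> V \<Longrightarrow> g x (Y x) (\<phi> x (Z x)) = c"
  shows "D (\<lambda>x. g x (Y u) (\<phi> x (Z u))) u v = - g u (D Y u v) (\<phi> u (Z u)) + g u (\<phi> u (Y u)) (D Z u v)"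
proof -
  have bil: "bilinear (\<lambda>y z. g x y (\<phi> x z))" if "x \<in> W" for x
    unfolding bilinear_def using that
    by (auto intro!: linearI simp: g_simps phi_simps)
  have sm: "smooth_on W (\<lambda>x. g x y (\<phi> x z))" for y z
    by (rule smooth_on_bilinear_app[OF open_W g_bilinear g_smooth smooth_on_const phi_smooth])
  from D_eqI[OF has_derivative_bilinear_app[OF open_W W[OF u] bil sm assms(2,3)], of v]
  show ?thesis
    using D_locally_const[OF u, of "\<lambda>x. g x (Y x) (\<phi> x (Z x))" c v, OF assms(4)]
      g_phi[OF W[OF u], of "Y u" "D Z u v"] by simp
qed

text \<open>This is the closedness of the fundamental form, evaluated on the frame.\<close>

lemma trace_free:
  assumes u: "u \<in> V"
  shows "g u (bracket \<xi> E2 u) (E1 u) = - c\<^sub>p u"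
proof -
  note d = frame_differentiable[OF u] and s = g_sym[OF W[OF u]]
  \<comment> \<open>After the trade, the derivatives of the frame fields combine into [\<xi>,E1]
    paired with \<open>E2\<close> and [\<xi>,E2] paired with \<open>E1\<close>, whose sum is
    zero.\<close>
  have "D (\<lambda>x. g x (E1 u) (\<phi> x (E2 u))) u (\<xi> u) + D (\<lambda>x. g x (E2 u) (\<phi> x (\<xi> u))) u (E1 u)
    + D (\<lambda>x. g x (\<xi> u) (\<phi> x (E1 u))) u (E2 u) = 0"
    using D_fundamental_cyclic[OF W[OF u]] by blast
  moreover have "D (\<lambda>x. g x (E1 u) (\<phi> x (E2 u))) u (\<xi> u) = - g u (D E1 u (\<xi> u)) (\<phi> u (E2 u)) + g u (\<phi> u (E1 u)) (D E2 u (\<xi> u))"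
    by (rule D_fundamental[OF u d(1,2), where c = "-1"]) (simp add: phi_E2 g_simps[OF W] gram)
  moreover have "D (\<lambda>x. g x (E2 u) (\<phi> x (\<xi> u))) u (E1 u) = - g u (D E2 u (E1 u)) (\<phi> u (\<xi> u)) + g u (\<phi> u (E2 u)) (D \<xi> u (E1 u))"
    by (rule D_fundamental[OF u d(2,3), where c = 0]) (simp add: phi_xi[OF W] g_simps[OF W])
  moreover have "D (\<lambda>x. g x (\<xi> u) (\<phi> x (E1 u))) u (E2 u) = - g u (D \<xi> u (E2 u)) (\<phi> u (E1 u)) + g u (\<phi> u (\<xi> u)) (D E1 u (E2 u))"
    by (rule D_fundamental[OF u d(3,1), where c = 0]) (simp add: phi_E1 g_xi[OF W] gram)
  ultimately show ?thesis
    using s[of "E1 u"] s[of "E2 u"]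
    by (simp add: c\<^sub>p_def bracket_def along_def phi_E1[OF u] phi_E2[OF u] phi_xi[OF W[OF u]] g_simps[OF W[OF u]])
qed

lemma brackets:
  assumes u: "u \<in> V"
  shows "bracket \<xi> E1 u = c\<^sub>p u *\<^sub>R E1 u + c\<^sub>q u *\<^sub>R E2 u"
    and "bracket \<xi> E2 u = c\<^sub>r u *\<^sub>R E1 u - c\<^sub>p u *\<^sub>R E2 u"
    and "bracket E1 E2 u = c\<^sub>a u *\<^sub>R E1 u - c\<^sub>b u *\<^sub>R E2 u + 2 *\<^sub>R \<xi> u"
  using expand[OF u, of "bracket \<xi> E1 u"] expand[OF u, of "bracket \<xi> E2 u"] expand[OF u, of "bracket E1 E2 u"]
  by (simp_all add: eta_bracket[OF u] trace_free[OF u] flip: c\<^sub>p_def c\<^sub>q_def c\<^sub>r_def c\<^sub>a_def) (simp_all add: c\<^sub>b_def algebra_simps)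

text \<open>The Koszul computation as a linear system: constancy of the Gram matrix gives the
  equations \<open>m\<close>, vanishing torsion gives \<open>t\<close>, and together they determine
  all 27 components. The rows for \<xi> are the known formula nabla_X \<xi> = - \<phi> X + \<phi> h
  X.\<close>

lemma nabla_frame:
  assumes u: "u \<in> V"
  shows "nabla \<Gamma> \<xi> \<xi> u = 0"
    and "nabla \<Gamma> E1 \<xi> u = - E1 u - c\<^sub>q u *\<^sub>R E2 u"
    and "nabla \<Gamma> E2 \<xi> u = E2 u - c\<^sub>r u *\<^sub>R E1 u"
    and "nabla \<Gamma> \<xi> E1 u = (c\<^sub>p u - 1) *\<^sub>R E1 u"
    and "nabla \<Gamma> \<xi> E2 u = (1 - c\<^sub>p u) *\<^sub>R E2 u"
    and "nabla \<Gamma> E1 E1 u = c\<^sub>b u *\<^sub>R E1 u + c\<^sub>q u *\<^sub>R \<xi> u"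
    and "nabla \<Gamma> E1 E2 u = - c\<^sub>b u *\<^sub>R E2 u + \<xi> u"
    and "nabla \<Gamma> E2 E1 u = - c\<^sub>a u *\<^sub>R E1 u - \<xi> u"
    and "nabla \<Gamma> E2 E2 u = c\<^sub>a u *\<^sub>R E2 u + c\<^sub>r u *\<^sub>R \<xi> u"
proof -
  note d = frame_differentiable[OF u]
  have m: "\<eta> u (nabla \<Gamma> X \<xi> u) = 0" "g u (nabla \<Gamma> X E1 u) (E1 u) = 0" "g u (nabla \<Gamma> X E2 u) (E2 u) = 0"
    "g u (nabla \<Gamma> X \<xi> u) (E1 u) = - \<eta> u (nabla \<Gamma> X E1 u)"
    "g u (nabla \<Gamma> X \<xi> u) (E2 u) = - \<eta> u (nabla \<Gamma> X E2 u)"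
    "g u (nabla \<Gamma> X E2 u) (E1 u) = - g u (nabla \<Gamma> X E1 u) (E2 u)" for X
    using metric_const[OF u d(3,3), of 1 X] metric_const[OF u d(1,1), of 0 X] metric_const[OF u d(2,2), of 0 X]
      metric_const[OF u d(3,1), of 0 X] metric_const[OF u d(3,2), of 0 X] metric_const[OF u d(1,2), of 1 X]
    by (simp_all add: g_xi[OF W[OF u]] g_xi[OF W] W gram eta_xi)
  have t: "\<eta> u (nabla \<Gamma> X Y u) - \<eta> u (nabla \<Gamma> Y X u) = \<eta> u (bracket X Y u)"
    "g u (nabla \<Gamma> X Y u) Z - g u (nabla \<Gamma> Y X u) Z = g u (bracket X Y u) Z" for X Y Z
    unfolding torsion[OF W[OF u], symmetric] eta_simps(3)[OF W[OF u]] g_simps(5)[OF W[OF u]] by simp_all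
  note t' = t[of \<xi> E1] t[of \<xi> E2] t[of E1 E2]
  note t'' = t'(1) t'(2)[of "E1 u"] t'(2)[of "E2 u"] t'(3) t'(4)[of "E1 u"] t'(4)[of "E2 u"] t'(5) t'(6)[of "E1 u"] t'(6)[of "E2 u"]
  note k = t''[unfolded brackets[OF u], simplified eta_simps[OF W[OF u]] g_simps[OF W[OF u]] gram[OF u] g_xi[OF W[OF u]] eta_xi[OF W[OF u]], simplified]
  note mm = m[of \<xi>] m[of E1] m[of E2]
  have e: "nabla \<Gamma> X Y u = z \<longleftrightarrow> \<eta> u (nabla \<Gamma> X Y u) = \<eta> u z \<and>
    g u (nabla \<Gamma> X Y u) (E1 u) = g u z (E1 u) \<and> g u (nabla \<Gamma> X Y u) (E2 u) = g u z (E2 u)" for X Y z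
    using vec_eqI[OF u] by metis
  show "nabla \<Gamma> \<xi> \<xi> u = 0"
    and "nabla \<Gamma> E1 \<xi> u = - E1 u - c\<^sub>q u *\<^sub>R E2 u"
    and "nabla \<Gamma> E2 \<xi> u = E2 u - c\<^sub>r u *\<^sub>R E1 u"
    and "nabla \<Gamma> \<xi> E1 u = (c\<^sub>p u - 1) *\<^sub>R E1 u"
    and "nabla \<Gamma> \<xi> E2 u = (1 - c\<^sub>p u) *\<^sub>R E2 u"
    and "nabla \<Gamma> E1 E1 u = c\<^sub>b u *\<^sub>R E1 u + c\<^sub>q u *\<^sub>R \<xi> u"
    and "nabla \<Gamma> E1 E2 u = - c\<^sub>b u *\<^sub>R E2 u + \<xi> u"
    and "nabla \<Gamma> E2 E1 u = - c\<^sub>a u *\<^sub>R E1 u - \<xi> u"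
    and "nabla \<Gamma> E2 E2 u = c\<^sub>a u *\<^sub>R E2 u + c\<^sub>r u *\<^sub>R \<xi> u"
    unfolding e
    by (simp_all only: eta_simps[OF W[OF u]] g_simps[OF W[OF u]] gram[OF u] g_xi[OF W[OF u]] eta_xi[OF W[OF u]] real_scaleR_def)
     (simp_all add: mm, ((intro conjI)?; use k mm in linarith)+)
qed

lemma nabla_linear:
  assumes u: "u \<in> V" and "Y differentiable at u" "X u = a *\<^sub>R A u + b *\<^sub>R B u + c *\<^sub>R C u"
  shows "nabla \<Gamma> X Y u = a *\<^sub>R nabla \<Gamma> A Y u + b *\<^sub>R nabla \<Gamma> B Y u + c *\<^sub>R nabla \<Gamma> C Y u"
  using linear_frechet_derivative[OF assms(2)] assms(3)
  by (simp add: nabla_def along_def Gamma_simps[OF W[OF u]] linear_add linear_scale algebra_simps)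

lemma nabla_leibniz:
  assumes u: "u \<in> V" and "f differentiable at u" "h differentiable at u" "Y differentiable at u" "Z differentiable at u"
  shows "nabla \<Gamma> X (\<lambda>x. f x *\<^sub>R Y x + h x *\<^sub>R Z x) u = D f u (X u) *\<^sub>R Y u + f u *\<^sub>R nabla \<Gamma> X Y u +
    D h u (X u) *\<^sub>R Z u + h u *\<^sub>R nabla \<Gamma> X Z u"
proof -
  have "((\<lambda>x. f x *\<^sub>R Y x + h x *\<^sub>R Z x) has_derivative
    (\<lambda>v. (f u *\<^sub>R D Y u v + D f u v *\<^sub>R Y u) + (h u *\<^sub>R D Z u v + D h u v *\<^sub>R Z u))) (at u)"
    using assms(2-) unfolding frechet_derivative_works
    by (intro has_derivative_add has_derivative_scaleR)
  from D_eqI[OF this, of "X u"] show ?thesis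
    by (simp add: nabla_def along_def Gamma_simps[OF W[OF u]] algebra_simps)
qed

text \<open>On an eigenvector of \<phi>, \<open>h\<close> extracts the part of its bracket with
  \<xi> lying in the opposite eigenspace, with a sign for \<open>E2\<close>; \<open>p\<close> drops
  out.\<close>

lemma h_frame:
  assumes u: "u \<in> V"
  shows "h_tensor \<phi> \<xi> E1 u = c\<^sub>q u *\<^sub>R E2 u" "h_tensor \<phi> \<xi> E2 u = - c\<^sub>r u *\<^sub>R E1 u"
proof -
  note d = frame_differentiable[OF u]
  have "bracket \<xi> (app \<phi> E1) u = bracket \<xi> E1 u"
    by (rule bracket_cong[OF open_V u]) (auto simp: app_def phi_E1 d)
  then show "h_tensor \<phi> \<xi> E1 u = c\<^sub>q u *\<^sub>R E2 u"
    by (simp add: h_tensor_def lie_derivative_def brackets[OF u] phi_simps[OF W[OF u]] phi_E1[OF u] phi_E2[OF u]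
      flip: scaleR_add_left)
  have "bracket \<xi> (app \<phi> E2) u = bracket \<xi> (\<lambda>x. - E2 x) u"
    by (rule bracket_cong[OF open_V u]) (auto simp: app_def phi_E2 d)
  also have "\<dots> = - bracket \<xi> E2 u" by (rule bracket_minus_right[OF d(3,2)])
  finally have e: "bracket \<xi> (app \<phi> E2) u = - (c\<^sub>r u *\<^sub>R E1 u - c\<^sub>p u *\<^sub>R E2 u)" by (simp only: brackets[OF u])
  show "h_tensor \<phi> \<xi> E2 u = - c\<^sub>r u *\<^sub>R E1 u"
    unfolding h_tensor_def lie_derivative_def e brackets[OF u]
    by (rule vec_eqI[OF u]) (simp_all only: phi_simps[OF W[OF u]] phi_E1[OF u] phi_E2[OF u]
      eta_simps[OF W[OF u]] g_simps[OF W[OF u]] gram[OF u], simp_all)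
qed

text \<open>The curvature condition is evaluated on three pairs. (E1,\<xi>) gives \<open>q r\<close>
  and \<xi> q; (E2,\<xi>) gives \<xi> r; on (E1,E2) the right-hand side vanishes, which gives E1 r
  and E2 q.\<close>

lemma curvature_structure:
  assumes u: "u \<in> V"
  shows "c\<^sub>q u * c\<^sub>r u = - (\<kappa> + 1)"
    and "D c\<^sub>q u (\<xi> u) = (\<mu> - 2 + 2 * c\<^sub>p u) * c\<^sub>q u"
    and "D c\<^sub>r u (\<xi> u) = (2 - \<mu> - 2 * c\<^sub>p u) * c\<^sub>r u"
    and "D c\<^sub>r u (E1 u) = - 2 * c\<^sub>b u * c\<^sub>r u"
    and "D c\<^sub>q u (E2 u) = - 2 * c\<^sub>a u * c\<^sub>q u"
proof -
  note d = frame_differentiable[OF u]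
  have dqr: "c\<^sub>q differentiable at u" "c\<^sub>r differentiable at u"
    using structure_smooth smooth_on_differentiable u by blast+
  \<comment> \<open>nabla_E1 \<xi> is known on all of \<open>V\<close>, so it may be replaced by its
    frame expression before differentiating once more; this is where derivatives of \<open>q\<close>
    appear.\<close>
  have N1: "nabla \<Gamma> X (nabla \<Gamma> E1 \<xi>) u = - nabla \<Gamma> X E1 u - D c\<^sub>q u (X u) *\<^sub>R E2 u - c\<^sub>q u *\<^sub>R nabla \<Gamma> X E2 u" for X
  proof -
    have df: "(\<lambda>x. (-1) *\<^sub>R E1 x + (- c\<^sub>q x) *\<^sub>R E2 x) differentiable at u"
      using d dqr by (intro differentiable_add differentiable_scaleR differentiable_minus) auto
    have "nabla \<Gamma> X (nabla \<Gamma> E1 \<xi>) u = nabla \<Gamma> X (\<lambda>x. (-1) *\<^sub>R E1 x + (- c\<^sub>q x) *\<^sub>R E2 x) u"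
      by (rule nabla_cong[OF open_V u _ df]) (simp add: nabla_frame)
    also have "\<dots> = - nabla \<Gamma> X E1 u - D c\<^sub>q u (X u) *\<^sub>R E2 u - c\<^sub>q u *\<^sub>R nabla \<Gamma> X E2 u"
      using nabla_leibniz[OF u differentiable_const differentiable_minus[OF dqr(1)] d(1,2), of X "-1"]
        D_eqI[OF has_derivative_minus[OF dqr(1)[unfolded frechet_derivative_works]]] by simp
    finally show ?thesis .
  qed
  have N2: "nabla \<Gamma> X (nabla \<Gamma> E2 \<xi>) u = nabla \<Gamma> X E2 u - D c\<^sub>r u (X u) *\<^sub>R E1 u - c\<^sub>r u *\<^sub>R nabla \<Gamma> X E1 u" for X
  proof -
    have df: "(\<lambda>x. 1 *\<^sub>R E2 x + (- c\<^sub>r x) *\<^sub>R E1 x) differentiable at u"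
      using d dqr by (intro differentiable_add differentiable_scaleR differentiable_minus) auto
    have "nabla \<Gamma> X (nabla \<Gamma> E2 \<xi>) u = nabla \<Gamma> X (\<lambda>x. 1 *\<^sub>R E2 x + (- c\<^sub>r x) *\<^sub>R E1 x) u"
      by (rule nabla_cong[OF open_V u _ df]) (simp add: nabla_frame)
    also have "\<dots> = nabla \<Gamma> X E2 u - D c\<^sub>r u (X u) *\<^sub>R E1 u - c\<^sub>r u *\<^sub>R nabla \<Gamma> X E1 u"
      using nabla_leibniz[OF u differentiable_const differentiable_minus[OF dqr(2)] d(2,1), of X 1]
        D_eqI[OF has_derivative_minus[OF dqr(2)[unfolded frechet_derivative_works]]] by simp
    finally show ?thesis .
  qed
  have N0: "nabla \<Gamma> X (nabla \<Gamma> \<xi> \<xi>) u = 0" for X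
  proof -
    have "nabla \<Gamma> X (nabla \<Gamma> \<xi> \<xi>) u = nabla \<Gamma> X (\<lambda>_. 0) u"
      by (rule nabla_cong[OF open_V u]) (simp_all add: nabla_frame)
    then show ?thesis by (simp add: nabla_def along_def Gamma_simps[OF W[OF u]])
  qed
  have B1: "nabla \<Gamma> (bracket E1 \<xi>) \<xi> u = (- c\<^sub>p u) *\<^sub>R nabla \<Gamma> E1 \<xi> u + (- c\<^sub>q u) *\<^sub>R nabla \<Gamma> E2 \<xi> u + 0 *\<^sub>R nabla \<Gamma> \<xi> \<xi> u"
    by (rule nabla_linear[OF u d(3)]) (use brackets(1)[OF u] in \<open>simp add: bracket_def algebra_simps\<close>)
  have B3: "nabla \<Gamma> (bracket E2 \<xi>) \<xi> u = (- c\<^sub>r u) *\<^sub>R nabla \<Gamma> E1 \<xi> u + c\<^sub>p u *\<^sub>R nabla \<Gamma> E2 \<xi> u + 0 *\<^sub>R nabla \<Gamma> \<xi> \<xi> u"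
    by (rule nabla_linear[OF u d(3)]) (use brackets(2)[OF u] in \<open>simp add: bracket_def algebra_simps\<close>)
  have B2: "nabla \<Gamma> (bracket E1 E2) \<xi> u = c\<^sub>a u *\<^sub>R nabla \<Gamma> E1 \<xi> u + (- c\<^sub>b u) *\<^sub>R nabla \<Gamma> E2 \<xi> u + 2 *\<^sub>R nabla \<Gamma> \<xi> \<xi> u"
    by (rule nabla_linear[OF u d(3)]) (use brackets(3)[OF u] in simp)
  note s = eta_simps[OF W[OF u]] g_simps[OF W[OF u]] gram[OF u] g_xi[OF W[OF u]] eta_xi[OF W[OF u]]
  have "g u (curvature \<Gamma> E1 \<xi> \<xi> u) X = g u (\<kappa> *\<^sub>R E1 u + (\<mu> * c\<^sub>q u) *\<^sub>R E2 u) X" for X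
    using curvature_eq[OF W[OF u] d(1,3)] by (simp add: s h_frame[OF u])
  from this[of "E1 u"] this[of "E2 u"]
  show "c\<^sub>q u * c\<^sub>r u = - (\<kappa> + 1)" "D c\<^sub>q u (\<xi> u) = (\<mu> - 2 + 2 * c\<^sub>p u) * c\<^sub>q u"
    by (simp_all only: curvature_def N0 N1 B1 nabla_frame[OF u] s) (simp_all add: algebra_simps)
  have "g u (curvature \<Gamma> E2 \<xi> \<xi> u) X = g u (\<kappa> *\<^sub>R E2 u - (\<mu> * c\<^sub>r u) *\<^sub>R E1 u) X" for X
    using curvature_eq[OF W[OF u] d(2,3)] by (simp add: s h_frame[OF u])
  from this[of "E2 u"]
  show "D c\<^sub>r u (\<xi> u) = (2 - \<mu> - 2 * c\<^sub>p u) * c\<^sub>r u"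
    by (simp_all only: curvature_def N0 N2 B3 nabla_frame[OF u] s) (simp_all add: algebra_simps)
  have "g u (curvature \<Gamma> E1 E2 \<xi> u) X = 0" for X
    using curvature_eq[OF W[OF u] d(1,2)] by (simp add: s)
  from this[of "E1 u"] this[of "E2 u"]
  show "D c\<^sub>r u (E1 u) = - 2 * c\<^sub>b u * c\<^sub>r u" "D c\<^sub>q u (E2 u) = - 2 * c\<^sub>a u * c\<^sub>q u"
    by (simp_all only: curvature_def N1 N2 B2 nabla_frame[OF u] s) (simp_all add: algebra_simps)
qed

end

section \<open>Normality on the frame, and rescaling\<close>

context local_frame
begin

text \<open>The tensor is bilinear and skew, so three pairs decide. (\<xi>,E1) gives 2 q E2 and
  (\<xi>,E2) gives 2 r E1; on (E1,E2) the term -2 \<xi> from \<phi>^2 is cancelled by d\<eta> =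
  \<Phi>. Its use is the contrapositive: failure of normality makes \<open>q\<close> or
  \<open>r\<close> nonzero.\<close>

lemma normality_eq_0:
  assumes u: "u \<in> V" and 0: "c\<^sub>q u = 0" "c\<^sub>r u = 0"
    and X: "X differentiable at u" and Y: "Y differentiable at u"
  shows "normality_tensor \<phi> \<xi> \<eta> X Y u = 0"
proof -
  \<comment> \<open>The tensor as a function of two tangent vectors at \<open>u\<close>, so that
    bilinearity and skewness can be stated.\<close>
  define N where "N x y = D (\<lambda>x. \<phi> x y) u (\<phi> u x) - D (\<lambda>z. \<phi> z x) u (\<phi> u y)
    + \<phi> u (D (\<lambda>z. \<phi> z x) u y) - \<phi> u (D (\<lambda>x. \<phi> x y) u x)
    - (2 * g u x (\<phi> u y)) *\<^sub>R \<xi> u" for x y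
  note d = frame_differentiable[OF u] and w = W[OF u]
  have N: "normality_tensor \<phi> \<xi> \<eta> X Y u = N (X u) (Y u)" if "X differentiable at u" "Y differentiable at u" for X Y
    unfolding N_def by (rule normality_tensorial[OF w that])
  have lin: "linear (N x)" for x
  proof -
    have L: "linear (\<lambda>v. D (\<lambda>z. \<phi> z a) u v)" for a
      by (rule linear_frechet_derivative[OF smooth_on_differentiable[OF phi_smooth w]])
    show ?thesis
      by (rule linearI)
        (simp_all add: N_def phi_simps[OF w] g_simps[OF w] linear_add[OF L] linear_scale[OF L]
          linear_add[OF D_phi_linear[OF w]] linear_scale[OF D_phi_linear[OF w]] algebra_simps)
  qed
  have skew: "N x y = - N y x" for x y
    unfolding N_def using g_phi[OF w, of x y] g_sym[OF w, of "\<phi> u x" y] by (simp add: algebra_simps)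
  have zero: "bracket (\<lambda>_. 0) Z u = 0" if "Z differentiable at u" for Z
    using linear_0[OF linear_frechet_derivative[OF that]] by (simp add: bracket_def along_def)
  have b0: "bracket (app \<phi> \<xi>) Z u = 0" if "Z differentiable at u" for Z
    using bracket_cong[OF open_V u, of "app \<phi> \<xi>" "\<lambda>_. 0" Z Z] that zero[OF that]
    by (simp add: app_def phi_xi W)
  have b1: "bracket Z (app \<phi> E1) u = bracket Z E1 u" "bracket (app \<phi> E1) Z u = bracket E1 Z u"
    if "Z differentiable at u" for Z
    using bracket_cong[OF open_V u, of Z Z "app \<phi> E1" E1] bracket_cong[OF open_V u, of "app \<phi> E1" E1 Z Z] that d(1)
    by (simp_all add: app_def phi_E1)
  have m2: "(\<lambda>x. - E2 x) differentiable at u" using d by simp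
  have b2: "bracket Z (app \<phi> E2) u = - bracket Z E2 u" if "Z differentiable at u" for Z
    using bracket_cong[OF open_V u, of Z Z "app \<phi> E2" "\<lambda>x. - E2 x"] that m2 bracket_minus_right[OF that d(2)]
    by (simp add: app_def phi_E2)
  have df: "app \<phi> Z differentiable at u" if "Z differentiable at u" for Z
    using has_derivative_phi[OF w that] by (auto simp: app_def[abs_def] differentiable_def)
  note s = phi_simps[OF w] phi_E1[OF u] phi_E2[OF u] phi_xi[OF w]
  have 1: "N (\<xi> u) (E1 u) = 0"
    unfolding N[OF d(3,1), symmetric] normality_tensor_def nijenhuis_def d1_eq[OF w d(3,1)]
      b0[OF df[OF d(1)]] b0[OF d(1)] b1(1)[OF d(3)] brackets[OF u] 0
    by (simp add: s g_xi[OF w] gram[OF u])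
  have 2: "N (\<xi> u) (E2 u) = 0"
    unfolding N[OF d(3,2), symmetric] normality_tensor_def nijenhuis_def d1_eq[OF w d(3,2)]
      b0[OF df[OF d(2)]] b0[OF d(2)] b2(1)[OF d(3)] brackets[OF u] 0
    by (simp add: s g_simps[OF w] g_xi[OF w] gram[OF u])
  have 3: "N (E1 u) (E2 u) = 0"
    unfolding N[OF d(1,2), symmetric] normality_tensor_def nijenhuis_def d1_eq[OF w d(1,2)]
      b1(2)[OF df[OF d(2)]] b1(2)[OF d(2)] b2(1)[OF d(1)] brackets[OF u] 0
    by (simp add: s g_simps[OF w] gram[OF u])
  have self: "N x x = 0" for x
    using skew[of x x] by (simp add: vec_eq_iff)
  have comb: "N x y = 0" if "N x (\<xi> u) = 0" "N x (E1 u) = 0" "N x (E2 u) = 0" for x y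
    using frame_combination[OF u, of y] that by (auto simp: linear_add[OF lin] linear_scale[OF lin])
  have "N (\<xi> u) y = 0" "N (E1 u) y = 0" "N (E2 u) y = 0" for y
    by (rule comb; simp add: 1 2 3 self skew[of "E1 u" "\<xi> u"] skew[of "E2 u" "\<xi> u"] skew[of "E2 u" "E1 u"])+
  note z = this
  have "N x y = 0" for x y
    by (rule comb; subst skew; simp add: z)
  then show ?thesis using N[OF X Y] by simp
qed

text \<open>The derivative of the factor contributes only a multiple of the same null vector, which
  pairs to zero. Hence \<open>q\<close> and \<open>r\<close> scale by squares with no derivative
  terms, and \<open>f h = 1\<close> preserves the normalisation.\<close>

lemma rescale:
  assumes V': "open V'" "V' \<subseteq> V" and sm: "smooth_on V' f" "smooth_on V' h"
    and fh: "\<And>x. x \<in> V' \<Longrightarrow> f x * h x = 1"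
  shows "local_frame W \<phi> \<xi> \<eta> g \<Gamma> \<kappa> \<mu> V' (\<lambda>x. f x *\<^sub>R E1 x) (\<lambda>x. h x *\<^sub>R E2 x)"
    and "x \<in> V' \<Longrightarrow> g x (bracket \<xi> (\<lambda>x. f x *\<^sub>R E1 x) x) (f x *\<^sub>R E1 x) = f x * f x * c\<^sub>q x"
    and "x \<in> V' \<Longrightarrow> g x (bracket \<xi> (\<lambda>x. h x *\<^sub>R E2 x) x) (h x *\<^sub>R E2 x) = h x * h x * c\<^sub>r x"
proof -
  have w: "x \<in> W" "x \<in> V" if "x \<in> V'" for x using that V' V_W by auto
  show "local_frame W \<phi> \<xi> \<eta> g \<Gamma> \<kappa> \<mu> V' (\<lambda>x. f x *\<^sub>R E1 x) (\<lambda>x. h x *\<^sub>R E2 x)"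
  proof
    show "open V'" "V' \<subseteq> W" using V' V_W by auto
    show "smooth_on V' (\<lambda>x. f x *\<^sub>R E1 x)" "smooth_on V' (\<lambda>x. h x *\<^sub>R E2 x)"
      by (intro smooth_on_scaleR V' sm smooth_on_subset[OF E1_smooth] smooth_on_subset[OF E2_smooth])+
    fix u assume "u \<in> V'"
    note u = w[OF this]
    show "\<phi> u (f u *\<^sub>R E1 u) = f u *\<^sub>R E1 u" "\<phi> u (h u *\<^sub>R E2 u) = - (h u *\<^sub>R E2 u)"
      by (simp_all add: phi_simps[OF u(1)] phi_E1[OF u(2)] phi_E2[OF u(2)])
    show "g u (f u *\<^sub>R E1 u) (h u *\<^sub>R E2 u) = 1"
      using fh[OF \<open>u \<in> V'\<close>] by (simp add: g_simps[OF u(1)] gram[OF u(2)] mult.commute)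
  qed
  assume "x \<in> V'"
  note u = w[OF this] and d = sm[THEN smooth_on_differentiable, OF this] frame_differentiable[OF w(2)[OF this]]
  show "g x (bracket \<xi> (\<lambda>x. f x *\<^sub>R E1 x) x) (f x *\<^sub>R E1 x) = f x * f x * c\<^sub>q x"
    unfolding bracket_scaleR_right[OF d(1,5,3)] by (simp add: g_simps[OF u(1)] gram[OF u(2)] c\<^sub>q_def)
  show "g x (bracket \<xi> (\<lambda>x. h x *\<^sub>R E2 x) x) (h x *\<^sub>R E2 x) = h x * h x * c\<^sub>r x"
    unfolding bracket_scaleR_right[OF d(2,5,4)] by (simp add: g_simps[OF u(1)] gram[OF u(2)] c\<^sub>r_def)
qed

end

section \<open>Normalised frames in a coordinate domain\<close>

lemma powr_half_mult: "0 < t \<Longrightarrow> t powr (-1/2) * t powr (1/2) = (1::real)"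
  "0 < t \<Longrightarrow> t powr (-1/2) * t powr (-1/2) = 1 / t" for t :: real
  by (simp_all flip: powr_add add: powr_minus_divide)

text \<open>The conclusion within one chart. \<phi> and \<xi> are parameters, so that the
  sign-reversed structure can be inserted.\<close>

definition normal_frame ::
  "(real^3) set \<Rightarrow> tensor11 \<Rightarrow> vfield \<Rightarrow> tensor02 \<Rightarrow> real \<Rightarrow> real \<Rightarrow> vfield \<Rightarrow> vfield \<Rightarrow> (real^3 \<Rightarrow> real) \<Rightarrow> real \<Rightarrow> bool" where
  "normal_frame V \<phi> \<xi> g \<kappa> \<mu> E1 E2 b \<epsilon> \<longleftrightarrow>
     smooth_on V E1 \<and> smooth_on V E2 \<and> smooth_on V b \<and>
     (\<forall>u\<in>V. span {\<xi> u, E1 u, E2 u} = UNIV \<and>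
        \<phi> u (E1 u) = E1 u \<and> \<phi> u (E2 u) = - E2 u \<and>
        g u (\<xi> u) (E1 u) = 0 \<and> g u (\<xi> u) (E2 u) = 0 \<and> g u (E1 u) (E2 u) = 1 \<and>
        bracket E1 E2 u = - b u *\<^sub>R E2 u + 2 *\<^sub>R \<xi> u \<and>
        bracket \<xi> E1 u = (1 - \<mu>/2) *\<^sub>R E1 u + \<epsilon> *\<^sub>R E2 u \<and>
        bracket \<xi> E2 u = - (\<epsilon> * (\<kappa> + 1)) *\<^sub>R E1 u - (1 - \<mu>/2) *\<^sub>R E2 u \<and>
        (\<kappa> \<noteq> -1 \<longrightarrow> b u = 0))"

context local_frame
begin

text \<open>\<epsilon> is its own inverse, so \<open>q r\<close> determines \<open>r\<close> as a
  constant too, and all derivatives of \<open>q\<close> and \<open>r\<close> vanish. For \<kappa> =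
  -1 this constant is zero and the equation for E1 r no longer restricts \<open>b\<close>.\<close>

lemma normal_frame_plus:
  assumes \<epsilon>: "\<epsilon> \<in> {1, -1}" and q: "\<And>x. x \<in> V \<Longrightarrow> c\<^sub>q x = \<epsilon>"
  shows "normal_frame V \<phi> \<xi> g \<kappa> \<mu> E1 E2 c\<^sub>b \<epsilon>"
proof -
  have r: "c\<^sub>r x = - \<epsilon> * (\<kappa> + 1)" if "x \<in> V" for x
    using curvature_structure(1)[OF that] q[OF that] \<epsilon> by auto
  have *: "bracket E1 E2 u = - c\<^sub>b u *\<^sub>R E2 u + 2 *\<^sub>R \<xi> u"
    "bracket \<xi> E1 u = (1 - \<mu>/2) *\<^sub>R E1 u + \<epsilon> *\<^sub>R E2 u"
    "bracket \<xi> E2 u = - (\<epsilon> * (\<kappa> + 1)) *\<^sub>R E1 u - (1 - \<mu>/2) *\<^sub>R E2 u"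
    "\<kappa> \<noteq> -1 \<longrightarrow> c\<^sub>b u = 0" if u: "u \<in> V" for u
  proof -
    have D: "D c\<^sub>q u v = 0" "D c\<^sub>r u v = 0" for v
      by (rule D_locally_const[OF u q], assumption) (rule D_locally_const[OF u r])
    have p: "c\<^sub>p u = 1 - \<mu>/2" using curvature_structure(2)[OF u] \<epsilon> unfolding D q[OF u] by auto
    have a: "c\<^sub>a u = 0" using curvature_structure(5)[OF u] \<epsilon> unfolding D q[OF u] by auto
    show "\<kappa> \<noteq> -1 \<longrightarrow> c\<^sub>b u = 0" using curvature_structure(4)[OF u] \<epsilon> unfolding D r[OF u] by auto
    show "bracket E1 E2 u = - c\<^sub>b u *\<^sub>R E2 u + 2 *\<^sub>R \<xi> u"
      "bracket \<xi> E1 u = (1 - \<mu>/2) *\<^sub>R E1 u + \<epsilon> *\<^sub>R E2 u"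
      "bracket \<xi> E2 u = - (\<epsilon> * (\<kappa> + 1)) *\<^sub>R E1 u - (1 - \<mu>/2) *\<^sub>R E2 u"
      unfolding brackets[OF u] p a q[OF u] r[OF u] by simp_all
  qed
  show ?thesis
    unfolding normal_frame_def
    using * structure_smooth E1_smooth E2_smooth frame_span phi_E1 phi_E2 gram by (auto simp: g_xi W)
qed

text \<open>The mirror case: reversing \<open>\<xi>\<close> and \<open>\<phi>\<close> exchanges the two null directions.\<close>

lemma normal_frame_minus:
  assumes \<kappa>: "\<kappa> = -1" and \<epsilon>: "\<epsilon> \<in> {1, -1}" and r: "\<And>x. x \<in> V \<Longrightarrow> c\<^sub>r x = - \<epsilon>"
  shows "normal_frame V (\<lambda>u v. - \<phi> u v) (\<lambda>u. - \<xi> u) g \<kappa> \<mu> E2 E1 c\<^sub>a \<epsilon>"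
proof -
  have q: "c\<^sub>q x = 0" if "x \<in> V" for x
    using curvature_structure(1)[OF that] r[OF that] \<epsilon> \<kappa> by auto
  \<comment> \<open>Exchanging the fields turns a E1 - b E2 + 2 \<xi> into - a E1 + b E2 + 2 (-
    \<xi>), so \<open>c\<^sub>a\<close> takes the place of \<open>b\<close>. The coefficient of
    \<open>E1\<close> in [-\<xi>,E2] is - r, hence the normalisation r = - \<epsilon>.\<close>
  have *: "bracket E2 E1 u = - c\<^sub>a u *\<^sub>R E1 u - 2 *\<^sub>R \<xi> u"
    "bracket (\<lambda>u. - \<xi> u) E2 u = (1 - \<mu>/2) *\<^sub>R E2 u + \<epsilon> *\<^sub>R E1 u"
    "bracket (\<lambda>u. - \<xi> u) E1 u = - ((1 - \<mu>/2) *\<^sub>R E1 u)" if u: "u \<in> V" for u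
  proof -
    note d = frame_differentiable[OF u]
    have D: "D c\<^sub>r u v = 0" for v by (rule D_locally_const[OF u r])
    have p: "c\<^sub>p u = 1 - \<mu>/2" using curvature_structure(3)[OF u] \<epsilon> unfolding D r[OF u] by auto
    have b: "c\<^sub>b u = 0" using curvature_structure(4)[OF u] \<epsilon> unfolding D r[OF u] by auto
    have m: "bracket (\<lambda>u. - \<xi> u) Z u = - bracket \<xi> Z u" if "Z differentiable at u" for Z
      using bracket_minus_right[OF that d(3)] bracket_swap[of "\<lambda>u. - \<xi> u" Z u] bracket_swap[of \<xi> Z u] by simp
    show "bracket E2 E1 u = - c\<^sub>a u *\<^sub>R E1 u - 2 *\<^sub>R \<xi> u"
      "bracket (\<lambda>u. - \<xi> u) E2 u = (1 - \<mu>/2) *\<^sub>R E2 u + \<epsilon> *\<^sub>R E1 u"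
      "bracket (\<lambda>u. - \<xi> u) E1 u = - ((1 - \<mu>/2) *\<^sub>R E1 u)"
      unfolding m[OF d(1)] m[OF d(2)] bracket_swap[of E2] brackets[OF u] p b q[OF u] r[OF u]
      by (simp_all add: scaleR_diff_left)
  qed
  have "span {- \<xi> u, E2 u, E1 u} = UNIV" if "u \<in> V" for u
  proof -
    have "span {\<xi> u, E1 u, E2 u} \<subseteq> span {- \<xi> u, E2 u, E1 u}"
      using span_neg[OF span_base[of "- \<xi> u" "{- \<xi> u, E2 u, E1 u}"]]
      by (intro span_minimal subspace_span) (auto intro: span_base)
    then show ?thesis using frame_span[OF that] by auto
  qed
  then show ?thesis
    unfolding normal_frame_def
    using * structure_smooth E1_smooth E2_smooth phi_E1 phi_E2 gram \<kappa>
    by (auto simp: g_xi W g_simps)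
qed

text \<open>Rescaling multiplies \<open>q\<close> by a positive square, so \<epsilon> has to be its
  sign. On the open set where \<epsilon> q > 0 the factor (\<epsilon> q)^(-1/2) on \<open>E1\<close>
  gives q / (\<epsilon> q) = \<epsilon>.\<close>

lemma normal_frame_exists_plus:
  assumes u: "u \<in> V" and q: "c\<^sub>q u \<noteq> 0"
  shows "\<exists>V' E1 E2 b. \<exists>\<epsilon>\<in>{1, -1}. open V' \<and> u \<in> V' \<and> V' \<subseteq> W \<and> normal_frame V' \<phi> \<xi> g \<kappa> \<mu> E1 E2 b \<epsilon>"
proof -
  define \<epsilon> where "\<epsilon> = sgn (c\<^sub>q u)"
  have \<epsilon>: "\<epsilon> \<in> {1, -1}" "0 < \<epsilon> * c\<^sub>q u" using q by (auto simp: \<epsilon>_def sgn_if)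
  let ?t = "\<lambda>x. \<epsilon> * c\<^sub>q x"
  have sm: "smooth_on V ?t"
    by (rule smooth_on_linear[OF bounded_linear_mult_right open_V structure_smooth(1)])
  define V' where "V' = V \<inter> ?t -` {0<..}"
  have V': "open V'" "V' \<subseteq> V" "u \<in> V'" "\<And>x. x \<in> V' \<Longrightarrow> 0 < ?t x"
    using continuous_open_preimage[OF smooth_on_continuous[OF sm] open_V] u \<epsilon> by (auto simp: V'_def)
  have sm': "smooth_on V' (\<lambda>x. ?t x powr a)" for a
    by (rule smooth_on_powr[OF V'(1,4) smooth_on_subset[OF sm V'(2)]])
  have fh: "?t x powr (-1/2) * ?t x powr (1/2) = 1" if "x \<in> V'" for x
    using powr_half_mult(1)[OF V'(4)[OF that]] .
  note R = rescale[OF V'(1,2) sm'[of "-1/2"] sm'[of "1/2"] fh]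
  interpret F: local_frame W \<phi> \<xi> \<eta> g \<Gamma> \<kappa> \<mu> V' "\<lambda>x. ?t x powr (-1/2) *\<^sub>R E1 x" "\<lambda>x. ?t x powr (1/2) *\<^sub>R E2 x"
    by (rule R(1))
  have "F.c\<^sub>q x = \<epsilon>" if "x \<in> V'" for x
  proof -
    have "F.c\<^sub>q x = ?t x powr (-1/2) * ?t x powr (-1/2) * c\<^sub>q x"
      unfolding F.c\<^sub>q_def by (rule R(2)[OF _ that])
    then show ?thesis
      unfolding powr_half_mult(2)[OF V'(4)[OF that]] using V'(4)[OF that] \<epsilon>(1) by auto
  qed
  from F.normal_frame_plus[OF \<epsilon>(1) this] show ?thesis using V' V_W \<epsilon>(1) by blast
qed

lemma normal_frame_exists_minus:
  assumes u: "u \<in> V" and r: "c\<^sub>r u \<noteq> 0" and \<kappa>: "\<kappa> = -1"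
  shows "\<exists>V' E1 E2 b. \<exists>\<epsilon>\<in>{1, -1}. open V' \<and> u \<in> V' \<and> V' \<subseteq> W \<and>
    normal_frame V' (\<lambda>u v. - \<phi> u v) (\<lambda>u. - \<xi> u) g \<kappa> \<mu> E1 E2 b \<epsilon>"
proof -
  \<comment> \<open>The minus sign anticipates the target r = - \<epsilon>. The exponents are
    exchanged as well, since it is now \<open>E2\<close> that is normalised.\<close>
  define \<epsilon> where "\<epsilon> = - sgn (c\<^sub>r u)"
  have \<epsilon>: "\<epsilon> \<in> {1, -1}" "0 < - \<epsilon> * c\<^sub>r u" using r by (auto simp: \<epsilon>_def sgn_if)
  let ?t = "\<lambda>x. - \<epsilon> * c\<^sub>r x"
  have sm: "smooth_on V ?t"
    by (rule smooth_on_linear[OF bounded_linear_mult_right open_V structure_smooth(2)])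
  define V' where "V' = V \<inter> ?t -` {0<..}"
  have V': "open V'" "V' \<subseteq> V" "u \<in> V'" "\<And>x. x \<in> V' \<Longrightarrow> 0 < ?t x"
    using continuous_open_preimage[OF smooth_on_continuous[OF sm] open_V] u \<epsilon> by (auto simp: V'_def)
  have sm': "smooth_on V' (\<lambda>x. ?t x powr a)" for a
    by (rule smooth_on_powr[OF V'(1,4) smooth_on_subset[OF sm V'(2)]])
  have fh: "?t x powr (1/2) * ?t x powr (-1/2) = 1" if "x \<in> V'" for x
    using powr_half_mult(1)[OF V'(4)[OF that]] by (simp add: mult.commute)
  note R = rescale[OF V'(1,2) sm'[of "1/2"] sm'[of "-1/2"] fh]
  interpret F: local_frame W \<phi> \<xi> \<eta> g \<Gamma> \<kappa> \<mu> V' "\<lambda>x. ?t x powr (1/2) *\<^sub>R E1 x" "\<lambda>x. ?t x powr (-1/2) *\<^sub>R E2 x"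
    by (rule R(1))
  have "F.c\<^sub>r x = - \<epsilon>" if "x \<in> V'" for x
  proof -
    have "F.c\<^sub>r x = ?t x powr (-1/2) * ?t x powr (-1/2) * c\<^sub>r x"
      unfolding F.c\<^sub>r_def by (rule R(3)[OF _ that])
    then show ?thesis
      unfolding powr_half_mult(2)[OF V'(4)[OF that]] using V'(4)[OF that] \<epsilon>(1) by auto
  qed
  from F.normal_frame_minus[OF \<kappa> \<epsilon>(1) this] show ?thesis using V' V_W \<epsilon>(1) by blast
qed

end

section \<open>Existence of adapted frames near a point\<close>

context paracontact_chart
begin

text \<open>Constant vectors are projected onto the two eigenspaces of \<phi>, which gives smooth
  eigenfields. Each eigenspace is isotropic, so nondegeneracy provides two projections with nonzero
  product at the point, hence nearby.\<close>

lemma local_frame_exists: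
  assumes u: "u \<in> W"
  shows "\<exists>V E1 E2. u \<in> V \<and> local_frame W \<phi> \<xi> \<eta> g \<Gamma> \<kappa> \<mu> V E1 E2"
proof -
  \<comment> \<open>For s = 1 or s = -1 this is the projection onto the eigenspace of \<phi> for the
    eigenvalue \<open>s\<close>; the two projections add up to \<phi>^2.\<close>
  define P where "P s x v = (1/2) *\<^sub>R (\<phi> x (\<phi> x v) + s *\<^sub>R \<phi> x v)" for s :: real and x v
  have phi3: "\<phi> x (\<phi> x (\<phi> x v)) = \<phi> x v" if "x \<in> W" for x v
    using phi_phi[OF that, of "\<phi> x v"] eta_phi[OF that] by simp
  have phi_P: "\<phi> x (P s x v) = s *\<^sub>R P s x v" if "x \<in> W" "s * s = 1" for s x v
    using that(2) by (simp add: P_def phi_simps[OF that(1)] phi3[OF that(1)] algebra_simps)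
  have eta_P: "\<eta> x (P s x v) = 0" if "x \<in> W" for s x v
    by (simp add: P_def eta_simps[OF that] eta_phi[OF that])
  have dec: "v = \<eta> x v *\<^sub>R \<xi> x + P s x v + P (- s) x v" if "x \<in> W" for x v s
  proof -
    have "P s x v + P (- s) x v = \<phi> x (\<phi> x v)" by (simp add: P_def vec_eq_iff field_simps)
    then show ?thesis by (simp add: phi_phi[OF that] add.assoc)
  qed
  have same: "g x (P s x v) (P s x w) = 0" if "x \<in> W" "s * s = 1" for x s v w
    using g_phi_phi[OF that(1), of "P s x v" "P s x w"] that(2)
    by (simp add: phi_P[OF that] eta_P[OF that(1)] g_simps[OF that(1)] flip: mult.assoc)
  have smP: "smooth_on W (\<lambda>x. P s x v)" for s v
  proof -
    have "smooth_on W (\<lambda>x. \<phi> x (\<phi> x v))"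
      by (rule smooth_on_app[OF open_W phi_linear phi_smooth phi_smooth])
    then show ?thesis unfolding P_def
      by (intro smooth_on_linear[OF bounded_linear_scaleR_right] smooth_on_add open_W phi_smooth)
  qed
  have "\<exists>v w. g u (P 1 u v) (P (-1) u w) \<noteq> 0"
  proof (rule ccontr)
    assume n: "\<not> ?thesis"
    have P0: "P s u v = 0" if s: "s = 1 \<or> s = -1" for s v
    proof (rule g_nondegenerate[OF u])
      fix w
      have "g u (P s u v) (P (- s) u w) = 0"
        using n s g_sym[OF u, of "P (-1) u v" "P 1 u w"] by auto
      then have "g u (P s u v) (\<eta> u w *\<^sub>R \<xi> u + P s u w + P (- s) u w) = 0"
        using s by (auto simp: g_simps[OF u] g_xi[OF u] eta_P[OF u] same[OF u])
      then show "g u (P s u v) w = 0" using dec[OF u, of w s] by simp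
    qed
    \<comment> \<open>With both projections zero every vector would be a multiple of \<xi>, which
      two coordinate axes refute.\<close>
    have *: "v = \<eta> u v *\<^sub>R \<xi> u" for v using dec[OF u, of v 1] P0 by simp
    have "axis 1 1 $ i = \<eta> u (axis 1 1) * \<xi> u $ i" "axis 2 1 $ i = \<eta> u (axis 2 1) * \<xi> u $ i" for i
      using *[of "axis 1 1"] *[of "axis 2 1"] by (metis vector_scaleR_component real_scaleR_def)+
    from this(1)[of 1] this(1)[of 2] this(2)[of 2] show False by (auto simp: axis_def)
  qed
  then obtain v w' where w': "g u (P 1 u v) (P (-1) u w') \<noteq> 0" by blast
  \<comment> \<open>The sign makes the pairing positive, so that its reciprocal can be written as a
    real power with exponent -1.\<close>
  define w where "w = sgn (g u (P 1 u v) (P (-1) u w')) *\<^sub>R w'"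
  have w: "0 < g u (P 1 u v) (P (-1) u w)"
  proof -
    have "P (-1) u w = sgn (g u (P 1 u v) (P (-1) u w')) *\<^sub>R P (-1) u w'"
      by (simp add: P_def w_def phi_simps[OF u] algebra_simps)
    then show ?thesis using w' by (simp add: g_simps[OF u] sgn_if)
  qed
  let ?k = "\<lambda>x. g x (P 1 x v) (P (-1) x w)"
  have smk: "smooth_on W ?k"
    by (rule smooth_on_bilinear_app[OF open_W g_bilinear g_smooth smP smP])
  define V where "V = W \<inter> ?k -` {0<..}"
  have V: "open V" "V \<subseteq> W" "u \<in> V" "\<And>x. x \<in> V \<Longrightarrow> 0 < ?k x"
    using continuous_open_preimage[OF smooth_on_continuous[OF smk] open_W] u w by (auto simp: V_def)
  have "local_frame W \<phi> \<xi> \<eta> g \<Gamma> \<kappa> \<mu> V (\<lambda>x. P 1 x v) (\<lambda>x. (?k x powr (-1)) *\<^sub>R P (-1) x w)"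
  proof
    show "open V" "V \<subseteq> W" by fact+
    show "smooth_on V (\<lambda>x. P 1 x v)" by (rule smooth_on_subset[OF smP V(2)])
    show "smooth_on V (\<lambda>x. (?k x powr (-1)) *\<^sub>R P (-1) x w)"
      by (rule smooth_on_scaleR[OF V(1) smooth_on_powr[OF V(1,4) smooth_on_subset[OF smk V(2)]]
            smooth_on_subset[OF smP V(2)]])
    fix x assume x: "x \<in> V"
    then have xw: "x \<in> W" using V by auto
    show "\<phi> x (P 1 x v) = P 1 x v" using phi_P[OF xw, of 1 v] by simp
    show "\<phi> x ((?k x powr (-1)) *\<^sub>R P (-1) x w) = - ((?k x powr (-1)) *\<^sub>R P (-1) x w)"
      using phi_P[OF xw, of "-1" w] by (simp add: phi_simps[OF xw])
    show "g x (P 1 x v) ((?k x powr (-1)) *\<^sub>R P (-1) x w) = 1"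
      using V(4)[OF x] by (simp add: g_simps[OF xw] powr_minus_divide)
  qed
  then show ?thesis using V(3) by blast
qed

lemma normal_frame_exists:
  assumes u: "u \<in> W"
    and nn: "\<kappa> \<noteq> -1 \<or> (\<exists>X Y. smooth_on W X \<and> smooth_on W Y \<and> normality_tensor \<phi> \<xi> \<eta> X Y u \<noteq> 0)"
  shows "\<exists>s\<in>{1, -1}. (\<kappa> \<noteq> -1 \<longrightarrow> s = 1) \<and> (\<exists>V E1 E2 b. \<exists>\<epsilon>\<in>{1, -1}. open V \<and> u \<in> V \<and> V \<subseteq> W \<and>
    normal_frame V (\<lambda>u v. s *\<^sub>R \<phi> u v) (\<lambda>u. s *\<^sub>R \<xi> u) g \<kappa> \<mu> E1 E2 b \<epsilon>)"
proof -
  obtain V E1 E2 where uV: "u \<in> V" and lf: "local_frame W \<phi> \<xi> \<eta> g \<Gamma> \<kappa> \<mu> V E1 E2"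
    using local_frame_exists[OF u] by blast
  interpret local_frame W \<phi> \<xi> \<eta> g \<Gamma> \<kappa> \<mu> V E1 E2 by (rule lf)
  \<comment> \<open>For \<kappa> \<noteq> -1 the product \<open>q r\<close> is nonzero, so the given
    sign of \<phi> works; the mirror case can arise only for \<kappa> = -1.\<close>
  have "c\<^sub>q u \<noteq> 0 \<or> \<kappa> = -1 \<and> c\<^sub>r u \<noteq> 0"
  proof (cases "\<kappa> = -1")
    case False
    then show ?thesis using curvature_structure(1)[OF uV] by auto
  next
    case True
    then show ?thesis using nn normality_eq_0[OF uV] smooth_on_differentiable u by blast
  qed
  then show ?thesis
  proof
    assume "c\<^sub>q u \<noteq> 0"
    from normal_frame_exists_plus[OF uV this] show ?thesis by (intro bexI[of _ 1]) auto
  next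
    assume "\<kappa> = -1 \<and> c\<^sub>r u \<noteq> 0"
    then show ?thesis using normal_frame_exists_minus[OF uV] by (intro bexI[of _ "-1"]) auto
  qed
qed

end

section \<open>Gluing over the manifold\<close>

text \<open>Differentiating Z' o \<tau> = D\<tau>(Z) in two ways produces second derivatives of
  \<tau>; in the bracket they cancel by symmetry.\<close>

lemma bracket_related:
  fixes \<tau> :: "real^3 \<Rightarrow> real^3"
  assumes "open S" "w \<in> S" and \<tau>: "smooth_on S \<tau>"
    and X': "\<And>w. w \<in> S \<Longrightarrow> X' (\<tau> w) = D \<tau> w (X w)" and Y': "\<And>w. w \<in> S \<Longrightarrow> Y' (\<tau> w) = D \<tau> w (Y w)"
    and "X differentiable at w" "Y differentiable at w" "X' differentiable at (\<tau> w)" "Y' differentiable at (\<tau> w)"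
  shows "bracket X' Y' (\<tau> w) = D \<tau> w (bracket X Y w)"
proof -
  have t: "(\<tau> has_derivative D \<tau> x) (at x)" if "x \<in> S" for x
    using smooth_on_has_derivative[OF \<tau> that] .
  have *: "D Z' (\<tau> w) (D \<tau> w v) = D (\<lambda>x. D \<tau> x (Z w)) w v + D \<tau> w (D Z w v)"
    if "\<And>w. w \<in> S \<Longrightarrow> Z' (\<tau> w) = D \<tau> w (Z w)" "Z differentiable at w" "Z' differentiable at (\<tau> w)" for Z Z' v
  proof -
    have "((\<lambda>x. D \<tau> x (Z x)) has_derivative (\<lambda>v. D (\<lambda>x. D \<tau> x (Z w)) w v + D \<tau> w (D Z w v))) (at w)"
      by (rule has_derivative_app[OF assms(1,2)])
        (auto intro: has_derivative_linear[OF t] smooth_on_differentiable[OF smooth_on_D[OF \<tau>] assms(2)] that(2))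
    then have "((\<lambda>x. Z' (\<tau> x)) has_derivative (\<lambda>v. D (\<lambda>x. D \<tau> x (Z w)) w v + D \<tau> w (D Z w v))) (at w)"
      by (rule has_derivative_transform_within_open[OF _ assms(1,2)]) (simp add: that(1))
    from has_derivative_unique[OF has_derivative_compose[OF t[OF assms(2)] that(3)[unfolded frechet_derivative_works]] this]
    show ?thesis by (rule fun_cong)
  qed
  show ?thesis
    using *[OF Y' assms(7,9), of "X w"] *[OF X' assms(6,8), of "Y w"] D_commute[OF assms(1-3), of "X w" "Y w"]
      linear_diff[OF has_derivative_linear[OF t[OF assms(2)]]] X'[OF assms(2)] Y'[OF assms(2)]
    by (simp add: bracket_def along_def)
qed

text \<open>Three pairwise orthogonal vectors of square 1 or -1 are independent, hence a basis, and
  pairing with them returns the coefficients up to sign.\<close>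

lemma lorentzian_nondegenerate:
  assumes "lorentzian B" and 0: "\<And>w. B v w = 0"
  shows "v = 0"
proof -
  obtain e :: "3 \<Rightarrow> real^3" where bil: "bilinear B" and sym: "\<And>v w. B v w = B w v"
    and e: "\<And>i j. B (e i) (e j) = (if i \<noteq> j then 0 else if i = 3 then -1 else 1)"
    using assms(1) unfolding lorentzian_def by blast
  let ?L = "\<lambda>y :: real^3. \<Sum>i\<in>UNIV. (y $ i) *\<^sub>R e i"
  have lin: "linear ?L" by (intro linearI) (simp_all add: scaleR_add_left sum.distrib scaleR_sum_right)
  have B: "B (?L y) (e j) = (if j = 3 then - y $ j else y $ j)" for y j
  proof -
    have L: "linear (\<lambda>x. B x (e j))" using bil by (simp add: bilinear_def)
    have "B (?L y) (e j) = (\<Sum>i\<in>UNIV. y $ i * B (e i) (e j))"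
      unfolding linear_sum[OF L] linear_scale[OF L] by simp
    also have "\<dots> = (\<Sum>i\<in>UNIV. if i = j then (if j = 3 then - y $ j else y $ j) else 0)"
      by (rule sum.cong) (auto simp: e)
    finally show ?thesis by simp
  qed
  have "y = 0" if "?L y = 0" for y
    using B[of y] bilinear_lzero[OF bil] unfolding that by (metis vec_eq_iff zero_index neg_equal_0_iff_equal)
  then have "inj ?L" using linear_injective_0[OF lin] by blast
  then have "surj ?L" by (rule linear_injective_imp_surjective[OF lin]) auto
  then obtain y where y: "v = ?L y" using surjD[of ?L v] by blast
  have "y $ j = 0" for j using B[of y j] 0[of "e j"] unfolding y by (auto split: if_splits)
  then show ?thesis unfolding y by simp
qed

section \<open>Chart changes and transport of fields between charts\<close>

locale atlas =
  fixes M :: "'a topology" and A :: "'a chart set"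
  assumes manifold: "smooth_3manifold M A"
begin

lemma chart: "c \<in> A \<Longrightarrow> openin M (fst c)" "c \<in> A \<Longrightarrow> open (snd c ` fst c)"
  "c \<in> A \<Longrightarrow> homeomorphic_map (subtopology M (fst c)) (top_of_set (snd c ` fst c)) (snd c)"
  using manifold unfolding smooth_3manifold_def chart_of_def by auto

lemma chart_subset: "c \<in> A \<Longrightarrow> fst c \<subseteq> topspace M"
  using chart(1) openin_subset by blast

lemma coords_topspace: "c \<in> A \<Longrightarrow> coords c (topspace M) = snd c ` fst c"
  using chart_subset unfolding coords_def by (metis inf.absorb1)

lemma point_of_chart: assumes "c \<in> A" "p \<in> fst c" shows "point_of c (snd c p) = p"
proof -
  have "inj_on (snd c) (fst c)"
    using homeomorphic_imp_injective_map[OF chart(3)[OF assms(1)]] chart_subset[OF assms(1)]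
    by (simp add: inf.absorb2)
  then show ?thesis using assms(2) by (simp add: point_of_def)
qed

lemma transition_chart: "c \<in> A \<Longrightarrow> p \<in> fst c \<Longrightarrow> transition c d (snd c p) = snd d p"
  by (simp add: transition_def point_of_chart)

lemma open_coords:
  assumes c: "c \<in> A" and U: "openin M U"
  shows "open (coords c U)"
proof -
  have "openin (top_of_set (snd c ` fst c)) (snd c ` (fst c \<inter> U))"
    using homeomorphic_imp_open_map[OF chart(3)[OF c]] openin_subtopology_Int2[OF U]
    unfolding open_map_def by blast
  then show ?thesis unfolding coords_def by (rule openin_open_trans[OF _ chart(2)[OF c]])
qed

lemma openin_chart_preimage:
  assumes c: "c \<in> A" and V: "open V"
  shows "openin M {p \<in> fst c. snd c p \<in> V}"
proof -
  have "openin (subtopology M (fst c)) {p \<in> topspace (subtopology M (fst c)). snd c p \<in> snd c ` fst c \<inter> V}"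
    by (rule openin_continuous_map_preimage[OF homeomorphic_imp_continuous_map[OF chart(3)[OF c]] openin_open_Int[OF V]])
  also have "{p \<in> topspace (subtopology M (fst c)). snd c p \<in> snd c ` fst c \<inter> V} = {p \<in> fst c. snd c p \<in> V}"
    using chart_subset[OF c] by auto
  finally show ?thesis using openin_trans_full chart(1)[OF c] by blast
qed

lemma transition_smooth: "c \<in> A \<Longrightarrow> d \<in> A \<Longrightarrow> smooth_on (coords c (fst d)) (transition c d)"
  using manifold unfolding smooth_3manifold_def by blast

lemma jacobian:
  assumes "c \<in> A" "d \<in> A" "p \<in> fst c" "p \<in> fst d"
  shows "(transition c d has_derivative jacobian c d (snd c p)) (at (snd c p))"
  unfolding jacobian_def
  by (rule smooth_on_has_derivative[OF transition_smooth[OF assms(1,2)]]) (use assms in \<open>auto simp: coords_def\<close>)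

lemma jacobian_linear:
  assumes "c \<in> A" "d \<in> A" "p \<in> fst c" "p \<in> fst d"
  shows "linear (jacobian c d (snd c p))"
  using has_derivative_linear[OF jacobian[OF assms]] .

lemma jacobian_self:
  assumes "c \<in> A" "p \<in> fst c"
  shows "jacobian c c (snd c p) v = v"
proof -
  have "((\<lambda>x. x) has_derivative (\<lambda>x. x)) (at (snd c p))" by simp
  then have "(transition c c has_derivative (\<lambda>x. x)) (at (snd c p))"
    by (rule has_derivative_transform_within_open[OF _ chart(2)[OF assms(1)]])
      (use assms in \<open>auto simp: transition_chart\<close>)
  then show ?thesis unfolding jacobian_def by (rule D_eqI)
qed

text \<open>Together with \<open>jacobian_self\<close> this also makes the jacobians invertible,
  which is how spanning frames stay spanning in other charts.\<close>

lemma jacobian_chain: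
  assumes cde: "c \<in> A" "d \<in> A" "e \<in> A" and p: "p \<in> fst c" "p \<in> fst d" "p \<in> fst e"
  shows "jacobian d e (snd d p) (jacobian c d (snd c p) v) = jacobian c e (snd c p) v"
proof -
  have "(transition d e has_derivative jacobian d e (snd d p)) (at (transition c d (snd c p)))"
    using jacobian[OF cde(2,3) p(2,3)] transition_chart[OF cde(1) p(1)] by simp
  from has_derivative_compose[OF jacobian[OF cde(1,2) p(1,2)] this]
  have "((\<lambda>x. transition d e (transition c d x)) has_derivative
      (\<lambda>v. jacobian d e (snd d p) (jacobian c d (snd c p) v))) (at (snd c p))" .
  then have "(transition c e has_derivative (\<lambda>v. jacobian d e (snd d p) (jacobian c d (snd c p) v))) (at (snd c p))"
    by (rule has_derivative_transform_within_open[OF _ open_coords[OF cde(1) chart(1)[OF cde(2)]]])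
      (use cde p in \<open>auto simp: coords_def transition_chart\<close>)
  from D_eqI[OF this, of v] show ?thesis unfolding jacobian_def by simp
qed

text \<open>A vector field is a family over all charts, while the frame is built in the single chart
  \<open>c0\<close>. The point \<open>u\<close> of chart \<open>c\<close> is carried back to
  \<open>c0\<close>, and the value found there is sent forward by the jacobian.\<close>

definition push :: "'a chart \<Rightarrow> vfield \<Rightarrow> 'a chart \<Rightarrow> vfield" where
  "push c0 X c u = jacobian c0 c (transition c c0 u) (X (transition c c0 u))"

lemma push_chart:
  "c \<in> A \<Longrightarrow> p \<in> fst c \<Longrightarrow> push c0 X c (snd c p) = jacobian c0 c (snd c0 p) (X (snd c0 p))"
  by (simp add: push_def transition_chart)

lemma smooth_on_transition:
  assumes c: "c \<in> A" "d \<in> A" and U: "openin M U" "U \<subseteq> fst d"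
  shows "smooth_on (coords c U) (transition c d)"
  by (rule smooth_on_subset[OF transition_smooth[OF c]]) (use U in \<open>auto simp: coords_def\<close>)

lemma vector_field_push:
  assumes c0: "c0 \<in> A" and U: "openin M U" "U \<subseteq> fst c0" and X: "smooth_on (coords c0 U) X"
  shows "vector_field A U (push c0 X)"
  unfolding vector_field_def
proof (intro conjI ballI)
  fix c assume c: "c \<in> A"
  let ?T = "coords c0 (fst c \<inter> U)"
  have T: "open ?T" using open_coords[OF c0] chart(1)[OF c] U by blast
  have "smooth_on ?T (\<lambda>w. jacobian c0 c w (X w))"
  proof (rule smooth_on_app[OF T, of "jacobian c0 c" X])
    show "linear (jacobian c0 c x)" if "x \<in> ?T" for x
      using jacobian_linear[OF c0 c] that by (auto simp: coords_def)
    show "smooth_on ?T (\<lambda>x. jacobian c0 c x v)" for v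
      unfolding jacobian_def
      by (intro smooth_on_D smooth_on_subset[OF transition_smooth[OF c0 c]]) (auto simp: coords_def)
    show "smooth_on ?T X" by (rule smooth_on_subset[OF X]) (auto simp: coords_def)
  qed
  then show "smooth_on (coords c U) (push c0 X c)"
    unfolding push_def[abs_def]
    by (rule smooth_on_compose[OF open_coords[OF c U(1)] T _ smooth_on_transition[OF c c0 U], rotated])
      (use c U in \<open>auto simp: coords_def transition_chart\<close>)
next
  fix c d u assume cd: "c \<in> A" "d \<in> A" and "u \<in> coords c (fst d \<inter> U)"
  then obtain p where p: "p \<in> fst c" "p \<in> fst d" "p \<in> U" "u = snd c p" by (auto simp: coords_def)
  then have p0: "p \<in> fst c0" using U by auto
  show "push c0 X d (transition c d u) = jacobian c d u (push c0 X c u)"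
    unfolding p(4) transition_chart[OF cd(1) p(1)] push_chart[OF cd(1) p(1)] push_chart[OF cd(2) p(2)]
    using jacobian_chain[OF c0 cd p0 p(1,2)] by simp
qed

end

text \<open>The local conclusion as a property of a point, so that the points where it holds for one
  sign form a set to which connectedness applies.\<close>

definition normal_form_at ::
  "'a topology \<Rightarrow> 'a chart set \<Rightarrow> ('a chart \<Rightarrow> tensor11) \<Rightarrow> ('a chart \<Rightarrow> vfield) \<Rightarrow> ('a chart \<Rightarrow> tensor02) \<Rightarrow>
   real \<Rightarrow> real \<Rightarrow> 'a \<Rightarrow> bool" where
  "normal_form_at M A \<phi> \<xi> g \<kappa> \<mu> p \<longleftrightarrow> (\<exists>U E1 E2 (b :: 'a \<Rightarrow> real). \<exists>\<epsilon>\<in>{1, -1 :: real}.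
       openin M U \<and> p \<in> U \<and> artin_frame A U \<phi> \<xi> g E1 E2 \<and> scalar_field A U b \<and>
       (\<forall>c\<in>A. \<forall>q\<in>fst c \<inter> U. let u = snd c q in
          bracket (E1 c) (E2 c) u = - b q *\<^sub>R E2 c u + 2 *\<^sub>R \<xi> c u \<and>
          bracket (\<xi> c) (E1 c) u = (1 - \<mu>/2) *\<^sub>R E1 c u + \<epsilon> *\<^sub>R E2 c u \<and>
          bracket (\<xi> c) (E2 c) u = - (\<epsilon> * (\<kappa> + 1)) *\<^sub>R E1 c u - (1 - \<mu>/2) *\<^sub>R E2 c u) \<and>
       (\<kappa> \<noteq> -1 \<longrightarrow> (\<forall>q\<in>U. b q = 0)))"

context atlas
begin

text \<open>The neighbourhood and frame obtained at \<open>p\<close> serve unchanged at each of its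
  other points.\<close>

lemma open_normal_form_at: "openin M {p \<in> topspace M. normal_form_at M A \<phi> \<xi> g \<kappa> \<mu> p}"
proof (subst openin_subopen, safe)
  fix p assume "normal_form_at M A \<phi> \<xi> g \<kappa> \<mu> p"
  then obtain U where "openin M U" "p \<in> U" "\<forall>q\<in>U. normal_form_at M A \<phi> \<xi> g \<kappa> \<mu> q"
    unfolding normal_form_at_def by fast
  then show "\<exists>T. openin M T \<and> p \<in> T \<and> T \<subseteq> {p \<in> topspace M. normal_form_at M A \<phi> \<xi> g \<kappa> \<mu> p}"
    using openin_subset by blast
qed

text \<open>Every condition in \<open>normal_frame\<close> is carried from \<open>c0\<close> to
  other charts by the jacobian: tensor identities by the transformation laws, brackets by
  naturality. Only these laws are assumed of \<phi>, \<xi> and g, so both signs are covered.\<close>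

lemma normal_form_atI:
  assumes \<phi>: "endo_field A (topspace M) \<phi>" and \<xi>: "vector_field A (topspace M) \<xi>"
    and g: "lorentz_metric A (topspace M) g"
    and c0: "c0 \<in> A" and p: "p \<in> fst c0" and V: "open V" "snd c0 p \<in> V" "V \<subseteq> snd c0 ` fst c0"
    and nf: "normal_frame V (\<phi> c0) (\<xi> c0) (g c0) \<kappa> \<mu> E1 E2 b \<epsilon>" and \<epsilon>: "\<epsilon> \<in> {1, -1}"
  shows "normal_form_at M A \<phi> \<xi> g \<kappa> \<mu> p"
proof -
  define U where "U = {q \<in> fst c0. snd c0 q \<in> V}"
  have U: "openin M U" "U \<subseteq> fst c0" "p \<in> U"
    using openin_chart_preimage[OF c0 V(1)] p V by (auto simp: U_def)
  have UM: "U \<subseteq> topspace M" using U openin_subset by blast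
  have cU: "coords c0 U = V" using V(3) by (auto simp: coords_def U_def)
  note nf' = nf[unfolded normal_frame_def]
  have sm: "smooth_on V E1" "smooth_on V E2" "smooth_on V b" using nf' by auto
  let ?E1 = "push c0 E1" and ?E2 = "push c0 E2" and ?b = "\<lambda>q. b (snd c0 q)"
  have vf: "vector_field A U ?E1" "vector_field A U ?E2"
    by (rule vector_field_push[OF c0 U(1,2)]; simp add: cU sm)+
  have sc: "scalar_field A U ?b"
    unfolding scalar_field_def
  proof
    fix c assume c: "c \<in> A"
    have "smooth_on (coords c U) (\<lambda>u. b (transition c c0 u))"
      by (rule smooth_on_compose[OF open_coords[OF c U(1)] V(1) _ smooth_on_transition[OF c c0 U(1,2)] sm(3)])
        (use c in \<open>auto simp: coords_def transition_chart U_def\<close>)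
    then show "smooth_on (coords c U) (\<lambda>u. ?b (point_of c u))" by (simp add: transition_def)
  qed
  have xi: "\<xi> c (snd c q) = jacobian c0 c (snd c0 q) (\<xi> c0 (snd c0 q))" if "c \<in> A" "q \<in> fst c" "q \<in> U" for c q
  proof -
    have "snd c0 q \<in> coords c0 (fst c \<inter> topspace M)" using that U(2) UM by (auto simp: coords_def)
    then have "\<xi> c (transition c0 c (snd c0 q)) = jacobian c0 c (snd c0 q) (\<xi> c0 (snd c0 q))"
      using \<xi> c0 that(1) unfolding vector_field_def by blast
    moreover have "transition c0 c (snd c0 q) = snd c q" using transition_chart[OF c0] that U(2) by blast
    ultimately show ?thesis by simp
  qed
  have phi: "\<phi> c (snd c q) (jacobian c0 c (snd c0 q) v) = jacobian c0 c (snd c0 q) (\<phi> c0 (snd c0 q) v)"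
    and gg: "g c (snd c q) (jacobian c0 c (snd c0 q) v) (jacobian c0 c (snd c0 q) w) = g c0 (snd c0 q) v w"
    if "c \<in> A" "q \<in> fst c" "q \<in> U" for c q v w
  proof -
    have *: "snd c0 q \<in> coords c0 (fst c \<inter> topspace M)" using that U(2) UM by (auto simp: coords_def)
    have t: "transition c0 c (snd c0 q) = snd c q" using transition_chart[OF c0] that U(2) by blast
    show "\<phi> c (snd c q) (jacobian c0 c (snd c0 q) v) = jacobian c0 c (snd c0 q) (\<phi> c0 (snd c0 q) v)"
      using \<phi> c0 that(1) * unfolding endo_field_def t[symmetric] by blast
    show "g c (snd c q) (jacobian c0 c (snd c0 q) v) (jacobian c0 c (snd c0 q) w) = g c0 (snd c0 q) v w"
      using g c0 that(1) * unfolding lorentz_metric_def t[symmetric] by blast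
  qed
  have lin: "linear (jacobian c0 c (snd c0 q))" if "c \<in> A" "q \<in> fst c" "q \<in> U" for c q
    using jacobian_linear[OF c0 that(1)] that U(2) by blast
  have at: "span {\<xi> c0 (snd c0 q), E1 (snd c0 q), E2 (snd c0 q)} = UNIV"
    "\<phi> c0 (snd c0 q) (E1 (snd c0 q)) = E1 (snd c0 q)" "\<phi> c0 (snd c0 q) (E2 (snd c0 q)) = - E2 (snd c0 q)"
    "g c0 (snd c0 q) (\<xi> c0 (snd c0 q)) (E1 (snd c0 q)) = 0" "g c0 (snd c0 q) (\<xi> c0 (snd c0 q)) (E2 (snd c0 q)) = 0"
    "g c0 (snd c0 q) (E1 (snd c0 q)) (E2 (snd c0 q)) = 1"
    "bracket E1 E2 (snd c0 q) = - b (snd c0 q) *\<^sub>R E2 (snd c0 q) + 2 *\<^sub>R \<xi> c0 (snd c0 q)"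
    "bracket (\<xi> c0) E1 (snd c0 q) = (1 - \<mu>/2) *\<^sub>R E1 (snd c0 q) + \<epsilon> *\<^sub>R E2 (snd c0 q)"
    "bracket (\<xi> c0) E2 (snd c0 q) = - (\<epsilon> * (\<kappa> + 1)) *\<^sub>R E1 (snd c0 q) - (1 - \<mu>/2) *\<^sub>R E2 (snd c0 q)"
    "\<kappa> \<noteq> -1 \<longrightarrow> b (snd c0 q) = 0"
    if "q \<in> U" for q
    using nf' that unfolding U_def by blast+
  have frame: "artin_frame A U \<phi> \<xi> g ?E1 ?E2"
    unfolding artin_frame_def
  proof (intro conjI ballI vf)
    fix c u assume c: "c \<in> A" and "u \<in> coords c U"
    then obtain q where q: "q \<in> fst c" "q \<in> U" "u = snd c q" by (auto simp: coords_def)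
    have q0: "q \<in> fst c0" using q U by auto
    let ?J = "jacobian c0 c (snd c0 q)"
    note e = q(3) xi[OF c q(1,2)] push_chart[OF c q(1)] phi[OF c q(1,2)] gg[OF c q(1,2)] at(2-6)[OF q(2)]
    show "\<phi> c u (?E1 c u) = ?E1 c u" "\<phi> c u (?E2 c u) = - ?E2 c u" "g c u (\<xi> c u) (?E1 c u) = 0"
      "g c u (\<xi> c u) (?E2 c u) = 0" "g c u (?E1 c u) (?E2 c u) = 1"
      unfolding e using linear_neg[OF lin[OF c q(1,2)]] by simp_all
    have "span {\<xi> c u, ?E1 c u, ?E2 c u} = span (?J ` {\<xi> c0 (snd c0 q), E1 (snd c0 q), E2 (snd c0 q)})"
      unfolding e by simp
    also have "\<dots> = ?J ` span {\<xi> c0 (snd c0 q), E1 (snd c0 q), E2 (snd c0 q)}"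
      by (rule linear_span_image[OF lin[OF c q(1,2)]])
    also have "\<dots> = range ?J" unfolding at(1)[OF q(2)] ..
    also have "\<dots> = UNIV"
    proof (rule surjI)
      show "?J (jacobian c c0 (snd c q) v) = v" for v
        unfolding jacobian_chain[OF c c0 c q(1) q0 q(1)] by (rule jacobian_self[OF c q(1)])
    qed
    finally show "span {\<xi> c u, ?E1 c u, ?E2 c u} = UNIV" .
  qed
  have br: "bracket X' Y' (snd c q) = jacobian c0 c (snd c0 q) (bracket X Y (snd c0 q))"
    if c: "c \<in> A" and q: "q \<in> fst c" "q \<in> U"
      and X': "\<And>q. q \<in> fst c \<Longrightarrow> q \<in> U \<Longrightarrow> X' (snd c q) = jacobian c0 c (snd c0 q) (X (snd c0 q))"
      and Y': "\<And>q. q \<in> fst c \<Longrightarrow> q \<in> U \<Longrightarrow> Y' (snd c q) = jacobian c0 c (snd c0 q) (Y (snd c0 q))"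
      and sm: "smooth_on V X" "smooth_on V Y" "smooth_on (coords c U) X'" "smooth_on (coords c U) Y'"
    for c q X Y X' Y'
  proof -
    let ?S = "coords c0 (fst c \<inter> U)"
    have S: "open ?S" using open_coords[OF c0] chart(1)[OF c] U(1) by blast
    have q0: "q \<in> fst c0" using q U by auto
    have qS: "snd c0 q \<in> ?S" using q q0 by (auto simp: coords_def)
    have tsm: "smooth_on ?S (transition c0 c)"
      by (rule smooth_on_subset[OF transition_smooth[OF c0 c]]) (auto simp: coords_def)
    have t: "transition c0 c (snd c0 q) = snd c q" by (rule transition_chart[OF c0 q0])
    have qV: "snd c0 q \<in> V" "snd c q \<in> coords c U" using q by (auto simp: U_def coords_def)
    have "bracket X' Y' (transition c0 c (snd c0 q)) = D (transition c0 c) (snd c0 q) (bracket X Y (snd c0 q))"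
    proof (rule bracket_related[OF S qS tsm])
      show "X' (transition c0 c w) = D (transition c0 c) w (X w)" "Y' (transition c0 c w) = D (transition c0 c) w (Y w)"
        if w: "w \<in> ?S" for w
      proof -
        obtain x where x: "x \<in> fst c0" "x \<in> fst c" "x \<in> U" "w = snd c0 x"
          using w by (auto simp: coords_def)
        show "X' (transition c0 c w) = D (transition c0 c) w (X w)" "Y' (transition c0 c w) = D (transition c0 c) w (Y w)"
          unfolding x(4) transition_chart[OF c0 x(1)] X'[OF x(2,3)] Y'[OF x(2,3)] jacobian_def by simp_all
      qed
      show "X differentiable at (snd c0 q)" "Y differentiable at (snd c0 q)"
        using sm(1,2) qV smooth_on_differentiable by blast+
      show "X' differentiable at (transition c0 c (snd c0 q))" "Y' differentiable at (transition c0 c (snd c0 q))"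
        unfolding t using sm(3,4) qV smooth_on_differentiable by blast+
    qed
    then show ?thesis by (simp add: t jacobian_def)
  qed
  have eqs: "bracket (?E1 c) (?E2 c) (snd c q) = - ?b q *\<^sub>R ?E2 c (snd c q) + 2 *\<^sub>R \<xi> c (snd c q) \<and>
          bracket (\<xi> c) (?E1 c) (snd c q) = (1 - \<mu>/2) *\<^sub>R ?E1 c (snd c q) + \<epsilon> *\<^sub>R ?E2 c (snd c q) \<and>
          bracket (\<xi> c) (?E2 c) (snd c q) = - (\<epsilon> * (\<kappa> + 1)) *\<^sub>R ?E1 c (snd c q) - (1 - \<mu>/2) *\<^sub>R ?E2 c (snd c q)"
    if c: "c \<in> A" and q: "q \<in> fst c" "q \<in> U" for c q
  proof -
    have s: "smooth_on (coords c U) (?E1 c)" "smooth_on (coords c U) (?E2 c)"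
      using vf c unfolding vector_field_def by auto
    have "smooth_on (coords d (topspace M)) (\<xi> d)" if "d \<in> A" for d
      using \<xi> that unfolding vector_field_def by auto
    then have x: "smooth_on (coords c U) (\<xi> c)" "smooth_on V (\<xi> c0)"
      using smooth_on_subset c c0 UM cU unfolding coords_def by (metis Int_mono image_mono order_refl)+
    note L = lin[OF c q]
    let ?J = "jacobian c0 c (snd c0 q)"
    have B: "bracket (?E1 c) (?E2 c) (snd c q) = ?J (bracket E1 E2 (snd c0 q))"
      "bracket (\<xi> c) (?E1 c) (snd c q) = ?J (bracket (\<xi> c0) E1 (snd c0 q))"
      "bracket (\<xi> c) (?E2 c) (snd c q) = ?J (bracket (\<xi> c0) E2 (snd c0 q))"
      by (rule br[OF c q]; (rule push_chart[OF c] xi[OF c] sm s x; assumption))+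
    show ?thesis
      unfolding B at(7-9)[OF q(2)] xi[OF c q] push_chart[OF c q(1)]
      by (simp add: linear_add[OF L] linear_diff[OF L] linear_scale[OF L] linear_neg[OF L])
  qed
  show ?thesis
    unfolding normal_form_at_def Let_def
    using U \<epsilon> frame sc eqs at(10)
    by (intro exI[of _ U] exI[of _ ?E1] exI[of _ ?E2] exI[of _ ?b] bexI[of _ \<epsilon>]) auto
qed

section \<open>From coordinate domains to the manifold\<close>

lemma paracontact_chart:
  assumes pm: "paracontact_metric M A \<phi> \<xi> \<eta> g" and km: "kappa_mu_space M A \<phi> \<xi> \<eta> g \<kappa> \<mu>"
    and c: "c \<in> A"
  shows "\<exists>\<Gamma>. paracontact_chart (snd c ` fst c) (\<phi> c) (\<xi> c) (\<eta> c) (g c) \<Gamma> \<kappa> \<mu>"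
proof -
  let ?W = "snd c ` fst c"
  note W = coords_topspace[OF c]
  have ap: "almost_paracontact_metric M A \<phi> \<xi> \<eta> g"
    and d_eta: "\<And>X Y u. smooth_on ?W X \<Longrightarrow> smooth_on ?W Y \<Longrightarrow> u \<in> ?W \<Longrightarrow>
      d1 (\<eta> c) X Y u = fundamental_form (\<phi> c) (g c) u (X u) (Y u)"
    using pm c unfolding paracontact_metric_def Let_def W[symmetric] by blast+
  have phi: "\<And>u. u \<in> ?W \<Longrightarrow> linear (\<phi> c u)" "\<And>v. smooth_on ?W (\<lambda>u. \<phi> c u v)"
    using ap c unfolding almost_paracontact_metric_def endo_field_def W[symmetric] by blast+
  have xi: "smooth_on ?W (\<xi> c)"
    using ap c unfolding almost_paracontact_metric_def vector_field_def W[symmetric] by blast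
  have eta: "\<And>u. u \<in> ?W \<Longrightarrow> linear (\<eta> c u)" "\<And>v. smooth_on ?W (\<lambda>u. \<eta> c u v)"
    using ap c unfolding almost_paracontact_metric_def one_form_def W[symmetric] by blast+
  have gg: "\<And>u. u \<in> ?W \<Longrightarrow> lorentzian (g c u)" "\<And>v w. smooth_on ?W (\<lambda>u. g c u v w)"
    using ap c unfolding almost_paracontact_metric_def lorentz_metric_def W[symmetric] by blast+
  have alg: "\<And>u v. u \<in> ?W \<Longrightarrow> \<phi> c u (\<phi> c u v) = v - \<eta> c u v *\<^sub>R \<xi> c u"
    "\<And>u. u \<in> ?W \<Longrightarrow> \<eta> c u (\<xi> c u) = 1"
    "\<And>u v w. u \<in> ?W \<Longrightarrow> g c u (\<phi> c u v) (\<phi> c u w) = - g c u v w + \<eta> c u v * \<eta> c u w"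
    using ap c unfolding almost_paracontact_metric_def W[symmetric] by blast+
  obtain \<Gamma> where lc: "levi_civita ?W (g c) \<Gamma>"
    and cu: "\<And>X Y u. smooth_on ?W X \<Longrightarrow> smooth_on ?W Y \<Longrightarrow> u \<in> ?W \<Longrightarrow> curvature \<Gamma> X Y (\<xi> c) u =
               \<kappa> *\<^sub>R (\<eta> c u (Y u) *\<^sub>R X u - \<eta> c u (X u) *\<^sub>R Y u) +
               \<mu> *\<^sub>R (\<eta> c u (Y u) *\<^sub>R h_tensor (\<phi> c) (\<xi> c) X u -
                     \<eta> c u (X u) *\<^sub>R h_tensor (\<phi> c) (\<xi> c) Y u)"
    using km c unfolding kappa_mu_space_def Let_def W[symmetric] by blast
  have "paracontact_chart ?W (\<phi> c) (\<xi> c) (\<eta> c) (g c) \<Gamma> \<kappa> \<mu>"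
  proof (rule paracontact_chart.intro)
    show "bilinear (g c u)" "g c u v w = g c u w v" if "u \<in> ?W" for u v w
      using gg(1)[OF that] unfolding lorentzian_def by blast+
    show "v = 0" if "u \<in> ?W" "\<And>w. g c u v w = 0" for u v
      by (rule lorentzian_nondegenerate[OF gg(1)[OF that(1)] that(2)])
    show "d1 (\<eta> c) X Y u = g c u (X u) (\<phi> c u (Y u))"
      if "smooth_on ?W X" "smooth_on ?W Y" "u \<in> ?W" for X Y u
      using d_eta[OF that] by (simp add: fundamental_form_def)
  qed (fact chart(2)[OF c] phi xi eta gg(2) alg lc cu)+
  then show ?thesis by blast
qed

lemma normal_form_at_exists:
  assumes pm: "paracontact_metric M A \<phi> \<xi> \<eta> g" and km: "kappa_mu_space M A \<phi> \<xi> \<eta> g \<kappa> \<mu>"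
    and p: "p \<in> topspace M" and nn: "\<kappa> = -1 \<longrightarrow> \<not> normal_at M A \<phi> \<xi> \<eta> p"
  shows "\<exists>s\<in>{1, -1}. (\<kappa> \<noteq> -1 \<longrightarrow> s = 1) \<and>
    normal_form_at M A (\<lambda>c u v. s *\<^sub>R \<phi> c u v) (\<lambda>c u. s *\<^sub>R \<xi> c u) g \<kappa> \<mu> p"
proof -
  \<comment> \<open>Failure of normality at \<open>p\<close> is witnessed in some particular chart,
    and that chart has to be used; for \<kappa> \<noteq> -1 any chart around \<open>p\<close> will
    do.\<close>
  have "\<exists>c\<in>A. p \<in> fst c \<and> (\<kappa> \<noteq> -1 \<or> (\<exists>X Y. smooth_on (snd c ` fst c) X \<and> smooth_on (snd c ` fst c) Y \<and>
      normality_tensor (\<phi> c) (\<xi> c) (\<eta> c) X Y (snd c p) \<noteq> 0))"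
  proof (cases "\<kappa> = -1")
    case True
    then obtain c where c: "c \<in> A" "p \<in> fst c" and "\<exists>X Y. smooth_on (coords c (topspace M)) X \<and>
        smooth_on (coords c (topspace M)) Y \<and> normality_tensor (\<phi> c) (\<xi> c) (\<eta> c) X Y (snd c p) \<noteq> 0"
      using nn unfolding normal_at_def Let_def by blast
    then show ?thesis using coords_topspace[OF c(1)] by auto
  next
    case False
    have "p \<in> (\<Union>c\<in>A. fst c)" using p manifold unfolding smooth_3manifold_def by blast
    then show ?thesis using False by blast
  qed
  then obtain c where c: "c \<in> A" "p \<in> fst c" and nn': "\<kappa> \<noteq> -1 \<or> (\<exists>X Y. smooth_on (snd c ` fst c) X \<and>
      smooth_on (snd c ` fst c) Y \<and> normality_tensor (\<phi> c) (\<xi> c) (\<eta> c) X Y (snd c p) \<noteq> 0)"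
    by blast
  obtain \<Gamma> where "paracontact_chart (snd c ` fst c) (\<phi> c) (\<xi> c) (\<eta> c) (g c) \<Gamma> \<kappa> \<mu>"
    using paracontact_chart[OF pm km c(1)] by blast
  then interpret paracontact_chart "snd c ` fst c" "\<phi> c" "\<xi> c" "\<eta> c" "g c" \<Gamma> \<kappa> \<mu> .
  have "snd c p \<in> snd c ` fst c" using c by blast
  from normal_frame_exists[OF this nn'] obtain s V E1 E2 b \<epsilon> where s: "s \<in> {1, -1}" "\<kappa> \<noteq> -1 \<longrightarrow> s = 1"
    and V: "open V" "snd c p \<in> V" "V \<subseteq> snd c ` fst c" and \<epsilon>: "\<epsilon> \<in> {1, -1}"
    and nf: "normal_frame V (\<lambda>u v. s *\<^sub>R \<phi> c u v) (\<lambda>u. s *\<^sub>R \<xi> c u) (g c) \<kappa> \<mu> E1 E2 b \<epsilon>" by blast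
  have ap: "endo_field A (topspace M) \<phi>" "vector_field A (topspace M) \<xi>" "lorentz_metric A (topspace M) g"
    using pm unfolding paracontact_metric_def almost_paracontact_metric_def by blast+
  have op: "open (coords d (topspace M))" if "d \<in> A" for d using open_coords[OF that] by simp
  have jl: "jacobian d e u (s *\<^sub>R v) = s *\<^sub>R jacobian d e u v"
    if "d \<in> A" "e \<in> A" "u \<in> coords d (fst e \<inter> topspace M)" for d e u v
    using linear_scale[OF jacobian_linear[OF that(1,2)]] that(3) by (auto simp: coords_def)
  have "endo_field A (topspace M) (\<lambda>c u v. s *\<^sub>R \<phi> c u v)"
    using ap(1) unfolding endo_field_def
    by (auto simp: jl intro!: linear_compose_scale_right smooth_on_linear[OF bounded_linear_scaleR_right op])
  moreover have "vector_field A (topspace M) (\<lambda>c u. s *\<^sub>R \<xi> c u)"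
    using ap(2) unfolding vector_field_def
    by (auto simp: jl intro!: smooth_on_linear[OF bounded_linear_scaleR_right op])
  ultimately have "normal_form_at M A (\<lambda>c u v. s *\<^sub>R \<phi> c u v) (\<lambda>c u. s *\<^sub>R \<xi> c u) g \<kappa> \<mu> p"
    using nf by (intro normal_form_atI[OF _ _ ap(3) c V _ \<epsilon>]) auto
  then show ?thesis using s by blast
qed

text \<open>Both forms make a statement about \<open>h\<close> on the +1 eigenline of \<phi>. The
  first gives h E1 = \<epsilon> E2, which is nonzero; in the second \<open>F2\<close> spans this
  line and \<kappa> + 1 = 0 gives h F2 = 0.\<close>

lemma normal_form_at_exclusive:
  assumes pm: "paracontact_metric M A \<phi> \<xi> \<eta> g" and km: "kappa_mu_space M A \<phi> \<xi> \<eta> g \<kappa> \<mu>"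
    and p: "p \<in> topspace M" and \<kappa>: "\<kappa> = -1"
    and plus: "normal_form_at M A \<phi> \<xi> g \<kappa> \<mu> p"
    and minus: "normal_form_at M A (\<lambda>c u v. - \<phi> c u v) (\<lambda>c u. - \<xi> c u) g \<kappa> \<mu> p"
  shows False
proof -
  have "p \<in> (\<Union>c\<in>A. fst c)" using p manifold unfolding smooth_3manifold_def by blast
  then obtain c where c: "c \<in> A" "p \<in> fst c" by blast
  let ?W = "snd c ` fst c" and ?u = "snd c p"
  obtain \<Gamma> where "paracontact_chart ?W (\<phi> c) (\<xi> c) (\<eta> c) (g c) \<Gamma> \<kappa> \<mu>"
    using paracontact_chart[OF pm km c(1)] by blast
  then interpret paracontact_chart ?W "\<phi> c" "\<xi> c" "\<eta> c" "g c" \<Gamma> \<kappa> \<mu> .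
  obtain U E1 E2 \<epsilon> where U: "openin M U" "p \<in> U" and af: "artin_frame A U \<phi> \<xi> g E1 E2" and \<epsilon>: "\<epsilon> \<in> {1, -1 :: real}"
    and br: "bracket (\<xi> c) (E1 c) ?u = (1 - \<mu>/2) *\<^sub>R E1 c ?u + \<epsilon> *\<^sub>R E2 c ?u"
    using plus c unfolding normal_form_at_def Let_def by blast
  obtain U' F1 F2 where U': "openin M U'" "p \<in> U'"
    and af': "artin_frame A U' (\<lambda>c u v. - \<phi> c u v) (\<lambda>c u. - \<xi> c u) g F1 F2"
    and "\<exists>\<epsilon>. bracket (\<lambda>u. - \<xi> c u) (F2 c) ?u = - (\<epsilon> * (\<kappa> + 1)) *\<^sub>R F1 c ?u - (1 - \<mu>/2) *\<^sub>R F2 c ?u"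
    using minus c unfolding normal_form_at_def Let_def by blast
  then have br': "bracket (\<lambda>u. - \<xi> c u) (F2 c) ?u = - ((1 - \<mu>/2) *\<^sub>R F2 c ?u)"
    by (auto simp: \<kappa>)
  have sub: "coords c U \<subseteq> ?W" "coords c U' \<subseteq> ?W" by (auto simp: coords_def)
  have u: "?u \<in> coords c U" "?u \<in> coords c U'" using c U U' by (auto simp: coords_def)
  interpret E: local_frame ?W "\<phi> c" "\<xi> c" "\<eta> c" "g c" \<Gamma> \<kappa> \<mu> "coords c U" "E1 c" "E2 c"
    using af open_coords[OF c(1) U(1)] sub c(1)
    by unfold_locales (auto simp: artin_frame_def vector_field_def)
  have F: "\<phi> c u (F1 c u) = - F1 c u" "\<phi> c u (F2 c u) = F2 c u" "g c u (F1 c u) (F2 c u) = 1"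
    if "u \<in> coords c U'" for u
  proof -
    have "- \<phi> c u (F1 c u) = F1 c u" "- \<phi> c u (F2 c u) = - F2 c u" "g c u (F1 c u) (F2 c u) = 1"
      using af' c(1) that unfolding artin_frame_def by blast+
    then show "\<phi> c u (F1 c u) = - F1 c u" "\<phi> c u (F2 c u) = F2 c u" "g c u (F1 c u) (F2 c u) = 1"
      by (simp_all add: equation_minus_iff)
  qed
  \<comment> \<open>The frame adapted to -\<phi>, with its members exchanged, is adapted to \<phi>;
    so both frames are compared within the same structure.\<close>
  interpret F: local_frame ?W "\<phi> c" "\<xi> c" "\<eta> c" "g c" \<Gamma> \<kappa> \<mu> "coords c U'" "F2 c" "F1 c"
  proof
    show "open (coords c U')" "coords c U' \<subseteq> ?W" using open_coords[OF c(1) U'(1)] sub by auto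
    show "smooth_on (coords c U') (F2 c)" "smooth_on (coords c U') (F1 c)"
      using af' c(1) unfolding artin_frame_def vector_field_def by blast+
    show "g c u (F2 c u) (F1 c u) = 1" if "u \<in> coords c U'" for u
      using F(3)[OF that] g_sym[of u] sub that by auto
  qed (fact F)+
  note w = E.W[OF u(1)]
  have "E.c\<^sub>q ?u = \<epsilon>"
    unfolding E.c\<^sub>q_def br by (simp add: g_simps[OF w] E.gram[OF u(1)])
  then have hE: "h_tensor (\<phi> c) (\<xi> c) (E1 c) ?u = \<epsilon> *\<^sub>R E2 c ?u"
    using E.h_frame(1)[OF u(1)] by simp
  have "bracket (\<xi> c) (F2 c) ?u = (1 - \<mu>/2) *\<^sub>R F2 c ?u"
    using br' bracket_minus_right[OF F.frame_differentiable(1,3)[OF u(2)]]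
      bracket_swap[of "\<lambda>u. - \<xi> c u" "F2 c" ?u] bracket_swap[of "\<xi> c" "F2 c" ?u] by simp
  then have "F.c\<^sub>q ?u = 0" unfolding F.c\<^sub>q_def by (simp add: g_simps[OF w] F.gram[OF u(2)])
  then have hF: "h_tensor (\<phi> c) (\<xi> c) (F2 c) ?u = 0"
    using F.h_frame(1)[OF u(2)] by simp
  define l where "l = g c ?u (F2 c ?u) (E2 c ?u)"
  \<comment> \<open>Two +1 eigenvectors pair to zero, so the expansion of \<open>F2\<close> in the
    other frame retains only the \<open>E1\<close> term.\<close>
  have "g c ?u (F2 c ?u) (E1 c ?u) = 0"
    using g_phi_phi[OF w, of "F2 c ?u" "E1 c ?u"]
    by (simp add: F.phi_E1[OF u(2)] E.phi_E1[OF u(1)] E.gram[OF u(1)])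
  then have l: "F2 c ?u = l *\<^sub>R E1 c ?u"
    using E.expand[OF u(1), of "F2 c ?u"] F.gram(1)[OF u(2)] by (simp add: l_def)
  have "l \<noteq> 0" using F.gram(5,6)[OF u(2)] by (auto simp: l g_simps[OF w])
  moreover have "h_tensor (\<phi> c) (\<xi> c) (F2 c) ?u = l *\<^sub>R h_tensor (\<phi> c) (\<xi> c) (E1 c) ?u"
    unfolding h_tensorial[OF w F.frame_differentiable(1)[OF u(2)]] h_tensorial[OF w E.frame_differentiable(1)[OF u(1)]] l
    by (simp add: linear_scale[OF D_phi_linear[OF w]] phi_simps[OF w]
        linear_scale[OF linear_frechet_derivative[OF E.frame_differentiable(3)[OF u(1)]]] algebra_simps)
  ultimately have "E2 c ?u = 0" using hE hF \<epsilon> by auto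
  then show False using E.gram(6)[OF u(1)] by (simp add: g_simps[OF w])
qed

end

text \<open>In the target form \<open>h E1\<close> is \<epsilon> E2, nonzero at every point. For
  \<kappa> = -1 the relation \<open>q r = 0\<close> alone does not exclude zeros of
  \<open>h\<close>; the pointwise hypothesis on normality does. A single sign \<open>s\<close> then
  serves the whole manifold.\<close>

theorem corollary4:
  fixes M :: "'a topology" and A :: "'a chart set"
    and \<phi> :: "'a chart \<Rightarrow> tensor11" and \<xi> :: "'a chart \<Rightarrow> vfield"
    and \<eta> :: "'a chart \<Rightarrow> form1" and g :: "'a chart \<Rightarrow> tensor02"
    and \<kappa> \<mu> :: real
  assumes "smooth_3manifold M A"
    and "paracontact_metric M A \<phi> \<xi> \<eta> g"
    and "kappa_mu_space M A \<phi> \<xi> \<eta> g \<kappa> \<mu>"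
    and "\<not> para_sasakian M A \<phi> \<xi> \<eta> g"
    and "\<kappa> = -1 \<longrightarrow> (\<forall>p\<in>topspace M. \<not> normal_at M A \<phi> \<xi> \<eta> p)"
  shows "\<exists>s\<in>{1, -1 :: real}. (\<kappa> \<noteq> -1 \<longrightarrow> s = 1) \<and>
    (let \<phi>' = (\<lambda>c u v. s *\<^sub>R \<phi> c u v); \<xi>' = (\<lambda>c u. s *\<^sub>R \<xi> c u) in
     \<forall>p\<in>topspace M. \<exists>U E1 E2 (b :: 'a \<Rightarrow> real). \<exists>\<epsilon>\<in>{1, -1 :: real}.
       openin M U \<and> p \<in> U \<and>
       artin_frame A U \<phi>' \<xi>' g E1 E2 \<and> scalar_field A U b \<and>
       (\<forall>c\<in>A. \<forall>q\<in>fst c \<inter> U. let u = snd c q in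
          bracket (E1 c) (E2 c) u = - b q *\<^sub>R E2 c u + 2 *\<^sub>R \<xi>' c u \<and>
          bracket (\<xi>' c) (E1 c) u = (1 - \<mu>/2) *\<^sub>R E1 c u + \<epsilon> *\<^sub>R E2 c u \<and>
          bracket (\<xi>' c) (E2 c) u = - (\<epsilon> * (\<kappa> + 1)) *\<^sub>R E1 c u - (1 - \<mu>/2) *\<^sub>R E2 c u) \<and>
       (\<kappa> \<noteq> -1 \<longrightarrow> (\<forall>q\<in>U. b q = 0)))"
proof -
  interpret atlas M A by (rule atlas.intro[OF assms(1)])
  define L where "L s p \<longleftrightarrow> normal_form_at M A (\<lambda>c u v. s *\<^sub>R \<phi> c u v) (\<lambda>c u. s *\<^sub>R \<xi> c u) g \<kappa> \<mu> p" for s p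
  have ex: "\<exists>s\<in>{1, -1}. (\<kappa> \<noteq> -1 \<longrightarrow> s = 1) \<and> L s p" if "p \<in> topspace M" for p
    unfolding L_def using normal_form_at_exists[OF assms(2,3) that] assms(5) that by blast
  have "\<exists>s\<in>{1, -1 :: real}. (\<kappa> \<noteq> -1 \<longrightarrow> s = 1) \<and> (\<forall>p\<in>topspace M. L s p)"
  proof (cases "\<kappa> = -1")
    case False
    then have "L 1 p" if "p \<in> topspace M" for p using ex[OF that] by auto
    then show ?thesis by (intro bexI[of _ 1]) auto
  next
    case True
    let ?S = "\<lambda>s. {p \<in> topspace M. L s p}"
    \<comment> \<open>The points admitting one sign or the other form two open sets that cover the
      manifold and are disjoint; connectedness makes one of them empty.\<close>
    have 1: "L 1 p \<or> L (-1) p" if "p \<in> topspace M" for p using ex[OF that] by auto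
    then have "topspace M \<subseteq> ?S 1 \<union> ?S (-1)" by auto
    moreover have "?S 1 \<inter> ?S (-1) = {}"
      using normal_form_at_exclusive[OF assms(2,3) _ True] by (auto simp: L_def)
    moreover have "connected_space M" using assms(1) unfolding smooth_3manifold_def by blast
    ultimately have "?S 1 = {} \<or> ?S (-1) = {}"
      using open_normal_form_at unfolding connected_space_def L_def by meson
    then show ?thesis
    proof
      assume "?S 1 = {}"
      then have "\<forall>p\<in>topspace M. L (-1) p" using 1 by auto
      then show ?thesis using True by (intro bexI[of _ "-1"]) auto
    next
      assume "?S (-1) = {}"
      then have "\<forall>p\<in>topspace M. L 1 p" using 1 by auto
      then show ?thesis by (intro bexI[of _ 1]) auto
    qed
  qed
  then show ?thesis unfolding L_def normal_form_at_def Let_def .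
qed

end
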